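(* For every $\varepsilon > 0$, there exists a deterministic algorithm for the Submodular Maximization subject to a Knapsack Constraint problem (SMK) which runs in $O(n \varepsilon^{-1} \log \varepsilon^{-1})$ time and always outputs a feasible set $S$ with $f(S) \geq (1/2 - \varepsilon) \cdot f(OPT)$, where $OPT$ is an optimal solution.
   Context: SMK: given a finite ground set $\mathcal{N}$ with $|\mathcal{N}| = n$, a non-negative monotone submodular function $f\colon 2^{\mathcal{N}} \to \mathbb{R}_{\geq 0}$ accessible through a value oracle, a non-negative cost function $c\colon \mathcal{N} \to \mathbb{R}_{\geq 0}$ and a budget $B > 0$, find a set $S \subseteq \mathcal{N}$ with $c(S) = \sum_{u \in S} c(u) \leq B$ (a feasible set) maximizing $f(S)$. Here $f$ is submodular if $f(S \cup \{u\}) - f(S) \geq f(T \cup \{u\}) - f(T)$ for all $S \subseteq T \subseteq \mathcal{N}$ and $u \notin T$, and monotone if $f(S) \leq f(T)$ whenever $S \subseteq T$. Running time counts each value oracle query as a unit-cost operation. *)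

theory Defs
  imports Complex_Main
begin

section \<open>Submodular maximization subject to a knapsack constraint\<close>

definition submodular_on :: "'a set \<Rightarrow> ('a set \<Rightarrow> real) \<Rightarrow> bool" where
  "submodular_on N f \<longleftrightarrow>
     (\<forall>S T u. S \<subseteq> T \<and> T \<subseteq> N \<and> u \<in> N \<and> u \<notin> T \<longrightarrow>
        f (S \<union> {u}) - f S \<ge> f (T \<union> {u}) - f T)"

definition monotone_set_fun_on :: "'a set \<Rightarrow> ('a set \<Rightarrow> real) \<Rightarrow> bool" where
  "monotone_set_fun_on N f \<longleftrightarrow> (\<forall>S T. S \<subseteq> T \<and> T \<subseteq> N \<longrightarrow> f S \<le> f T)"

definition smk_instance :: "'a set \<Rightarrow> ('a set \<Rightarrow> real) \<Rightarrow> ('a \<Rightarrow> real) \<Rightarrow> real \<Rightarrow> bool" where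
  "smk_instance N f c B \<longleftrightarrow>
     finite N \<and> (\<forall>S\<subseteq>N. 0 \<le> f S) \<and> monotone_set_fun_on N f \<and> submodular_on N f \<and>
     (\<forall>u\<in>N. 0 \<le> c u) \<and> 0 < B"

definition smk_feasible :: "'a set \<Rightarrow> ('a \<Rightarrow> real) \<Rightarrow> real \<Rightarrow> 'a set \<Rightarrow> bool" where
  "smk_feasible N c B S \<longleftrightarrow> S \<subseteq> N \<and> (\<Sum>u\<in>S. c u) \<le> B"

definition smk_optimal ::
    "'a set \<Rightarrow> ('a set \<Rightarrow> real) \<Rightarrow> ('a \<Rightarrow> real) \<Rightarrow> real \<Rightarrow> 'a set \<Rightarrow> bool" where
  "smk_optimal N f c B S \<longleftrightarrow>
     smk_feasible N c B S \<and> (\<forall>T. smk_feasible N c B T \<longrightarrow> f T \<le> f S)"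

section \<open>A real RAM with a value oracle\<close>

text \<open>
  Programs of a deterministic random access machine that computes with natural numbers (used for
  addressing and counting) and with exact real numbers. Variables and arrays are named by natural
  numbers; array names are fixed in the program text, array indices are computed. Naturals support
  only addition and truncated subtraction, and no rounding from reals to naturals is available, so
  that the unit cost measure cannot be exploited through long integers. All literals are natural
  numbers.
\<close>

datatype nexp =
    NLit nat
  | NVar nat
  | NArr nat nexp
  | NAdd nexp nexp
  | NSub nexp nexp

datatype rexp =
    RLit nat
  | RVar nat
  | RArr nat nexp
  | RAdd rexp rexp
  | RSub rexp rexp
  | RMul rexp rexp
  | RDiv rexp rexp

datatype bexp =
    NLess nexp nexp
  | RLess rexp rexp
  | BNot bexp
  | BAnd bexp bexp

datatype com =
    Skip
  | NAssign nat nexp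
  | RAssign nat rexp
  | NStore nat nexp nexp
  | RStore nat nexp rexp
  | Query nat nat
  | Seq com com
  | If bexp com com
  | While bexp com

record state =
  nvar :: "nat \<Rightarrow> nat"
  rvar :: "nat \<Rightarrow> real"
  narr :: "nat \<Rightarrow> nat \<Rightarrow> nat"
  rarr :: "nat \<Rightarrow> nat \<Rightarrow> real"

fun nval :: "nexp \<Rightarrow> state \<Rightarrow> nat" where
  "nval (NLit k) s = k"
| "nval (NVar x) s = nvar s x"
| "nval (NArr a i) s = narr s a (nval i s)"
| "nval (NAdd d e) s = nval d s + nval e s"
| "nval (NSub d e) s = nval d s - nval e s"

fun rval :: "rexp \<Rightarrow> state \<Rightarrow> real" where
  "rval (RLit k) s = real k"
| "rval (RVar x) s = rvar s x"
| "rval (RArr a i) s = rarr s a (nval i s)"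
| "rval (RAdd d e) s = rval d s + rval e s"
| "rval (RSub d e) s = rval d s - rval e s"
| "rval (RMul d e) s = rval d s * rval e s"
| "rval (RDiv d e) s = rval d s / rval e s"

fun bval :: "bexp \<Rightarrow> state \<Rightarrow> bool" where
  "bval (NLess d e) s \<longleftrightarrow> nval d s < nval e s"
| "bval (RLess d e) s \<longleftrightarrow> rval d s < rval e s"
| "bval (BNot b) s \<longleftrightarrow> \<not> bval b s"
| "bval (BAnd b b') s \<longleftrightarrow> bval b s \<and> bval b' s"

text \<open>Evaluating an expression costs one time unit per node of its syntax tree.\<close>

fun ntime :: "nexp \<Rightarrow> nat" where
  "ntime (NLit k) = 1"
| "ntime (NVar x) = 1"
| "ntime (NArr a i) = 1 + ntime i"
| "ntime (NAdd d e) = 1 + ntime d + ntime e"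
| "ntime (NSub d e) = 1 + ntime d + ntime e"

fun rtime :: "rexp \<Rightarrow> nat" where
  "rtime (RLit k) = 1"
| "rtime (RVar x) = 1"
| "rtime (RArr a i) = 1 + ntime i"
| "rtime (RAdd d e) = 1 + rtime d + rtime e"
| "rtime (RSub d e) = 1 + rtime d + rtime e"
| "rtime (RMul d e) = 1 + rtime d + rtime e"
| "rtime (RDiv d e) = 1 + rtime d + rtime e"

fun btime :: "bexp \<Rightarrow> nat" where
  "btime (NLess d e) = 1 + ntime d + ntime e"
| "btime (RLess d e) = 1 + rtime d + rtime e"
| "btime (BNot b) = 1 + btime b"
| "btime (BAnd b b') = 1 + btime b + btime b'"

text \<open>The subset of \<open>{..<n}\<close> whose characteristic vector is held in the array \<open>a\<close>.\<close>

definition array_set :: "nat \<Rightarrow> state \<Rightarrow> nat \<Rightarrow> nat set" where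
  "array_set n s a = {i. i < n \<and> narr s a i \<noteq> 0}"

text \<open>
  \<open>exec n F p s t s'\<close>: with ground set \<open>{..<n}\<close> and value oracle \<open>F\<close>, the program \<open>p\<close> started in
  state \<open>s\<close> halts in state \<open>s'\<close> after exactly \<open>t\<close> time units. The oracle is used only by \<open>Query\<close>,
  which costs one unit.
\<close>

inductive exec ::
    "nat \<Rightarrow> (nat set \<Rightarrow> real) \<Rightarrow> com \<Rightarrow> state \<Rightarrow> nat \<Rightarrow> state \<Rightarrow> bool"
  for n F where
  Skip: "exec n F Skip s 1 s"
| NAssign: "exec n F (NAssign x e) s (1 + ntime e) (s\<lparr>nvar := (nvar s)(x := nval e s)\<rparr>)"
| RAssign: "exec n F (RAssign x e) s (1 + rtime e) (s\<lparr>rvar := (rvar s)(x := rval e s)\<rparr>)"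
| NStore: "exec n F (NStore a i e) s (1 + ntime i + ntime e)
    (s\<lparr>narr := (narr s)(a := (narr s a)(nval i s := nval e s))\<rparr>)"
| RStore: "exec n F (RStore a i e) s (1 + ntime i + rtime e)
    (s\<lparr>rarr := (rarr s)(a := (rarr s a)(nval i s := rval e s))\<rparr>)"
| Query: "exec n F (Query x a) s 1 (s\<lparr>rvar := (rvar s)(x := F (array_set n s a))\<rparr>)"
| Seq: "exec n F p s t s' \<Longrightarrow> exec n F q s' t' s'' \<Longrightarrow> exec n F (Seq p q) s (t + t') s''"
| IfTrue: "bval b s \<Longrightarrow> exec n F p s t s' \<Longrightarrow> exec n F (If b p q) s (btime b + t) s'"
| IfFalse: "\<not> bval b s \<Longrightarrow> exec n F q s t s' \<Longrightarrow> exec n F (If b p q) s (btime b + t) s'"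
| WhileFalse: "\<not> bval b s \<Longrightarrow> exec n F (While b p) s (btime b) s"
| WhileTrue: "bval b s \<Longrightarrow> exec n F p s t s' \<Longrightarrow> exec n F (While b p) s' t' s'' \<Longrightarrow>
    exec n F (While b p) s (btime b + t + t') s''"

inductive_cases SkipE: "exec n F Skip s t s'"
inductive_cases NAssignE: "exec n F (NAssign x e) s t s'"
inductive_cases RAssignE: "exec n F (RAssign x e) s t s'"
inductive_cases NStoreE: "exec n F (NStore a i e) s t s'"
inductive_cases RStoreE: "exec n F (RStore a i e) s t s'"
inductive_cases QueryE: "exec n F (Query x a) s t s'"
inductive_cases SeqE: "exec n F (Seq p q) s t s'"
inductive_cases IfE: "exec n F (If b p q) s t s'"
inductive_cases WhileE: "exec n F (While b p) s t s'"

lemma exec_deterministic: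
  "exec n F p s t s' \<Longrightarrow> exec n F p s u r \<Longrightarrow> u = t \<and> r = s'"
proof (induction arbitrary: u r rule: exec.induct)
  case (Seq p s t s' q t' s'')
  from Seq.prems show ?case by (rule SeqE) (use Seq.IH in blast)
next
  case (IfTrue b s p t s' q)
  from IfTrue.prems show ?case by (rule IfE) (use IfTrue in blast)+
next
  case (IfFalse b s q t s' p)
  from IfFalse.prems show ?case by (rule IfE) (use IfFalse in blast)+
next
  case (WhileFalse b s p)
  from WhileFalse.prems show ?case by (rule WhileE) (use WhileFalse in blast)+
next
  case (WhileTrue b s p t s' t' s'')
  from WhileTrue.prems show ?case by (rule WhileE) (use WhileTrue in blast)+
qed (auto elim: SkipE NAssignE RAssignE NStoreE RStoreE QueryE)+

text \<open>
  An instance is presented through an enumeration \<open>e\<close> of the ground set by \<open>{..<n}\<close>, where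
  \<open>n = card N\<close>. Initially variable 0 on the natural side holds \<open>n\<close>, real variables 0 and 1 hold the
  budget and the accuracy parameter, real array 0 holds the costs, and everything else is 0. The
  objective is not part of the memory; it is accessible only through queries. The solution is read
  off natural array 0.
\<close>

definition smk_input ::
    "real \<Rightarrow> 'a set \<Rightarrow> ('a \<Rightarrow> real) \<Rightarrow> real \<Rightarrow> (nat \<Rightarrow> 'a) \<Rightarrow> state" where
  "smk_input \<epsilon> N c B e =
     \<lparr>nvar = (\<lambda>_. 0)(0 := card N),
      rvar = (\<lambda>_. 0)(0 := B, 1 := \<epsilon>),
      narr = (\<lambda>_ _. 0),
      rarr = (\<lambda>_ _. 0)(0 := (\<lambda>i. if i < card N then c (e i) else 0))\<rparr>"

definition smk_runs ::
    "com \<Rightarrow> real \<Rightarrow> 'a set \<Rightarrow> ('a set \<Rightarrow> real) \<Rightarrow> ('a \<Rightarrow> real) \<Rightarrow> real \<Rightarrow> (nat \<Rightarrow> 'a) \<Rightarrow>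
     nat \<Rightarrow> 'a set \<Rightarrow> bool" where
  "smk_runs p \<epsilon> N f c B e t S \<longleftrightarrow>
     (\<exists>s. exec (card N) (\<lambda>I. f (e ` I)) p (smk_input \<epsilon> N c B e) t s \<and>
          S = e ` array_set (card N) s 0)"

end

theory Submission
  imports Defs
begin

text \<open>
  A single pass that accepts \<open>u\<close> whenever its marginal density is at least \<open>f A / B\<close> yields an
  estimate \<open>V = f A\<close> with \<open>V / 5 \<le> f OPT \<le> 2 V\<close>. Then the ``greedy plus best single addition''
  algorithm is run with \<open>m = O(1 / \<epsilon>)\<close> and density thresholds \<open>V m / B\<close>, decreasing geometrically by
  \<open>1 - 1 / m\<close> to \<open>O(V / B)\<close>. The search for the best single addition takes linear time, so it is done
  only once per scan, and a scan stops as soon as it has gained \<open>V / m\<close>; this costs a \<open>1 / m\<close> fraction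
  of the value and at most \<open>2 m\<close> additional scans.

  For the ratio, take a window \<open>W\<close> such that the relevant elements of \<open>OPT\<close> fit as long as the greedy
  set \<open>G\<close> costs at most \<open>W\<close>. While this holds and no good set has been found, some of these elements
  has density at least \<open>f OPT / (2 W)\<close>, so \<open>G\<close> grows at about this density and reaches value
  \<open>f OPT / 2\<close> once its cost exceeds \<open>W\<close>.
\<close>

section \<open>Combinatorial analysis\<close>

locale smk =
  fixes n :: nat and F :: "nat set \<Rightarrow> real" and c :: "nat \<Rightarrow> real" and B :: real
  assumes inst: "smk_instance {..<n} F c B"
begin

abbreviation feasible :: "nat set \<Rightarrow> bool" where
  "feasible \<equiv> smk_feasible {..<n} c B"

section \<open>Consequences of monotonicity and submodularity\<close>

lemma F_nonneg: "S \<subseteq> {..<n} \<Longrightarrow> 0 \<le> F S"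
  and F_mono: "S \<subseteq> T \<Longrightarrow> T \<subseteq> {..<n} \<Longrightarrow> F S \<le> F T"
  and c_nonneg: "i < n \<Longrightarrow> 0 \<le> c i"
  and B_pos: "0 < B"
  using inst by (auto simp: smk_instance_def monotone_set_fun_on_def)

lemma cost_nonneg: "S \<subseteq> {..<n} \<Longrightarrow> 0 \<le> sum c S"
  by (intro sum_nonneg c_nonneg) auto

lemma cost_mono: "S \<subseteq> T \<Longrightarrow> T \<subseteq> {..<n} \<Longrightarrow> sum c S \<le> sum c T"
  by (intro sum_mono2 c_nonneg finite_subset[of T "{..<n}"]) auto

text \<open>For \<open>u\<close> in \<open>T\<close>, a case the definition of submodularity leaves
  out, the left side is 0 and monotonicity makes the right side non-negative.\<close>

lemma marginal_antimono:
  assumes "S \<subseteq> T" "T \<subseteq> {..<n}" "u < n"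
  shows "F (insert u T) - F T \<le> F (insert u S) - F S"
proof (cases "u \<in> T")
  case True
  have "F S \<le> F (insert u S)" using assms by (intro F_mono) auto
  then show ?thesis using True by (simp add: insert_absorb)
next
  case False
  then show ?thesis using inst assms by (auto simp: smk_instance_def submodular_on_def)
qed

lemma marginal_set_antimono:
  assumes "S \<subseteq> T" "T \<subseteq> {..<n}" "X \<subseteq> {..<n}"
  shows "F (T \<union> X) - F T \<le> F (S \<union> X) - F S"
proof -
  have "finite X" using assms(3) finite_subset by blast
  then show ?thesis using assms(3)
  proof (induction X)
    case empty
    show ?case by simp
  next
    case (insert x X)
    have "F (insert x (T \<union> X)) - F (T \<union> X) \<le> F (insert x (S \<union> X)) - F (S \<union> X)"
      using insert.prems assms by (intro marginal_antimono) auto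
    with insert show ?case by simp
  qed
qed

lemma F_Un_le: "S \<subseteq> {..<n} \<Longrightarrow> T \<subseteq> {..<n} \<Longrightarrow> F (S \<union> T) \<le> F S + F T"
  using marginal_set_antimono[of "{}" S T] F_nonneg[of "{}"] by simp

lemma F_Un_le_marginals:
  assumes "S \<subseteq> {..<n}" "T \<subseteq> {..<n}"
  shows "F (S \<union> T) \<le> F S + (\<Sum>u\<in>T - S. F (insert u S) - F S)"
proof -
  have "finite T" using assms(2) finite_subset by blast
  then show ?thesis using assms(2)
  proof (induction T)
    case empty
    show ?case by simp
  next
    case (insert x T)
    show ?case
    proof (cases "x \<in> S")
      case True
      then show ?thesis using insert by (simp add: insert_absorb)
    next
      case False
      have "F (insert x (S \<union> T)) - F (S \<union> T) \<le> F (insert x S) - F S"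
        using insert.prems assms by (intro marginal_antimono) auto
      with insert False show ?thesis by (simp add: insert_Diff_if)
    qed
  qed
qed

text \<open>The gain is at most the sum of the single marginals over \<open>T - S\<close>, and each
  of these is charged to its cost. The lower estimate of the optimum and both cases of the window
  argument rest on this inequality.\<close>

lemma F_Un_le_density:
  assumes "S \<subseteq> {..<n}" "T \<subseteq> {..<n}" "0 \<le> \<theta>" "sum c T \<le> d"
    and "\<And>u. u \<in> T \<Longrightarrow> u \<notin> S \<Longrightarrow> F (insert u S) - F S \<le> \<theta> * c u"
  shows "F (S \<union> T) \<le> F S + \<theta> * d"
proof -
  have "(\<Sum>u\<in>T - S. F (insert u S) - F S) \<le> (\<Sum>u\<in>T - S. \<theta> * c u)"
    by (rule sum_mono) (use assms in auto)
  also have "\<dots> = \<theta> * sum c (T - S)" by (simp add: sum_distrib_left)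
  also have "\<dots> \<le> \<theta> * d"
    using cost_mono[of "T - S" T] assms by (intro mult_left_mono) auto
  finally show ?thesis using F_Un_le_marginals[OF assms(1,2)] by linarith
qed

subsection \<open>Constant factor estimate of the optimum\<close>

text \<open>The density test is multiplied out, so that elements of cost 0 need no separate
  treatment. The set may exceed the budget; only its value matters.\<close>

fun estimate_set :: "nat \<Rightarrow> nat set" where
  "estimate_set 0 = {}"
| "estimate_set (Suc j) = (let A = estimate_set j in
     if c j \<le> B \<and> c j * F A \<le> B * (F (insert j A) - F A) then insert j A else A)"

lemma estimate_set_subset: "estimate_set j \<subseteq> {..<j}"
  by (induction j) (auto simp: Let_def)

text \<open>A rejected element had low density at its turn. As the set grows, marginals fall by
  submodularity while the bound rises by monotonicity, so the inequality persists.\<close>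

lemma estimate_set_dense:
  assumes "j \<le> n" "u < j" "u \<notin> estimate_set j" "c u \<le> B"
  shows "F (insert u (estimate_set j)) - F (estimate_set j) \<le> F (estimate_set j) / B * c u"
  using assms
proof (induction j)
  case 0
  then show ?case by simp
next
  case (Suc j)
  let ?A = "estimate_set j" and ?A' = "estimate_set (Suc j)"
  have sub: "?A \<subseteq> ?A'" "?A' \<subseteq> {..<n}"
    using estimate_set_subset[of "Suc j"] Suc.prems by (auto simp: Let_def)
  have "F (insert u ?A) - F ?A \<le> F ?A / B * c u"
  proof (cases "u = j")
    case True
    then have "B * (F (insert u ?A) - F ?A) < c u * F ?A"
      using Suc.prems by (auto simp: Let_def split: if_splits)
    then show ?thesis using B_pos by (simp add: field_simps)
  next
    case False
    then show ?thesis using Suc by (auto simp: Let_def split: if_splits)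
  qed
  also have "\<dots> \<le> F ?A' / B * c u"
    using F_mono[OF sub] B_pos c_nonneg[of u] Suc.prems
    by (intro mult_right_mono divide_right_mono) auto
  finally show ?case using marginal_antimono[OF sub, of u] Suc.prems by linarith
qed

text \<open>Elements of \<open>T\<close> outside the estimation set have density at most its value
  divided by \<open>B\<close>; their total cost is at most \<open>B\<close>, so adding them at most
  doubles the value.\<close>

lemma estimate_lower:
  assumes "feasible T"
  shows "F T \<le> 2 * F (estimate_set n)"
proof -
  let ?A = "estimate_set n"
  have sub: "?A \<subseteq> {..<n}" "T \<subseteq> {..<n}"
    using assms estimate_set_subset by (auto simp: smk_feasible_def)
  have "c u \<le> B" if "u \<in> T" for u
    using cost_mono[of "{u}" T] that assms by (auto simp: smk_feasible_def)
  then have "F (?A \<union> T) \<le> F ?A + F ?A / B * B"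
    using sub assms F_nonneg B_pos
    by (intro F_Un_le_density estimate_set_dense) (auto simp: smk_feasible_def)
  then show ?thesis using F_mono[of T "?A \<union> T"] sub B_pos by simp
qed

text \<open>
  Each accepted element multiplies the value by at least \<open>1 + c u / B\<close>, so the value doubles
  whenever the elements accepted since some prefix \<open>P\<close> overflow the budget; half of the value is
  then due to a feasible set and one further element.
\<close>

lemma estimate_decomposition:
  assumes opt: "\<And>T. feasible T \<Longrightarrow> F T \<le> M" and "j \<le> n"
  shows "\<exists>P S. estimate_set j = P \<union> S \<and> F P \<le> 4 * M \<and> feasible S \<and>
    F P * (1 + sum c S / B) \<le> F (estimate_set j)"
  using \<open>j \<le> n\<close>
proof (induction j)
  case 0
  have "feasible {}" using B_pos by (simp add: smk_feasible_def)
  then show ?case using opt[of "{}"] F_nonneg[of "{}"]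
    by (intro exI[of _ "{}"]) simp
next
  case (Suc j)
  let ?A = "estimate_set j" and ?A' = "estimate_set (Suc j)"
  obtain P S where PS: "?A = P \<union> S" "F P \<le> 4 * M" "feasible S" "F P * (1 + sum c S / B) \<le> F ?A"
    using Suc by auto
  have jn: "j < n" using Suc.prems by simp
  have sub: "?A \<subseteq> {..<j}" "?A \<subseteq> {..<n}" "P \<subseteq> {..<n}" "S \<subseteq> {..<n}" "j \<notin> S" "finite S"
    using estimate_set_subset[of j] jn PS(1) by (auto intro: finite_subset)
  show ?case
  proof (cases "?A' = ?A")
    case True
    then show ?thesis using PS by metis
  next
    case False
    then have A': "?A' = insert j ?A" and cj: "c j \<le> B"
      and gain: "c j * F ?A \<le> B * (F (insert j ?A) - F ?A)"
      by (auto simp: Let_def split: if_splits)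
    have "F ?A * (1 + c j / B) \<le> F ?A'"
      using gain A' B_pos by (simp add: field_simps)
    have nn: "0 \<le> F P" "0 \<le> c j" "0 \<le> sum c S" "0 \<le> F S"
      using sub F_nonneg c_nonneg jn cost_nonneg by auto
    have "F P * (1 + sum c (insert j S) / B) \<le> F P * ((1 + sum c S / B) * (1 + c j / B))"
      using nn B_pos sub by (intro mult_left_mono) (auto simp: field_simps)
    also have "\<dots> \<le> F ?A * (1 + c j / B)"
      using PS(4) nn B_pos by (simp flip: mult.assoc) (intro mult_right_mono; simp)
    also have "\<dots> \<le> F ?A'" by fact
    finally have growth: "F P * (1 + sum c (insert j S) / B) \<le> F ?A'" .
    show ?thesis
    proof (cases "sum c (insert j S) \<le> B")
      case True
      then have "feasible (insert j S)" using sub jn by (simp add: smk_feasible_def)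
      then show ?thesis using PS(1,2) growth A'
        by (intro exI[of _ P] exI[of _ "insert j S"]) auto
    next
      case False
      then have "F P * 2 \<le> F P * (1 + sum c (insert j S) / B)"
        using nn B_pos by (intro mult_left_mono) (auto simp: field_simps)
      with growth have "2 * F P \<le> F ?A'" by simp
      moreover have "F ?A' \<le> F P + F S + F {j}"
        using F_Un_le[of "P \<union> S" "{j}"] F_Un_le[of P S] sub jn A' PS(1) by auto
      moreover have "F S \<le> M" "F {j} \<le> M"
        using opt[of S] opt[of "{j}"] PS(3) cj jn by (auto simp: smk_feasible_def)
      \<comment> \<open>From \<open>2 * F P \<le> F ?A' \<le> F P + 2 * M\<close> follows
        \<open>F P \<le> 2 * M\<close>, whence the constant 4. The prefix then restarts at
        \<open>?A'\<close> with an empty remainder.\<close>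
      ultimately have "F ?A' \<le> 4 * M" by linarith
      then show ?thesis using B_pos
        by (intro exI[of _ ?A'] exI[of _ "{}"]) (auto simp: smk_feasible_def)
    qed
  qed
qed

text \<open>The prefix \<open>P\<close> contributes at most \<open>4 * M\<close> and the feasible
  remainder \<open>S\<close> at most \<open>M\<close>.\<close>

lemma estimate_upper:
  assumes opt: "\<And>T. feasible T \<Longrightarrow> F T \<le> M"
  shows "F (estimate_set n) \<le> 5 * M"
proof -
  obtain P S where PS: "estimate_set n = P \<union> S" "F P \<le> 4 * M" "feasible S"
    using estimate_decomposition[OF opt, of n] by auto
  have "P \<subseteq> {..<n}" "S \<subseteq> {..<n}" using PS(1) estimate_set_subset[of n] by auto
  then have "F (P \<union> S) \<le> F P + F S" by (rule F_Un_le)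
  then show ?thesis using PS opt[of S] by simp
qed

subsection \<open>Threshold greedy with single additions\<close>

text \<open>Including \<open>G\<close> itself makes a bound on all candidates bound
  \<open>F G\<close> as well; \<open>candidates {}\<close> supplies the affordable
  singletons.\<close>

definition candidates :: "nat set \<Rightarrow> nat set set" where
  "candidates G = insert G {insert i G | i. i < n \<and> i \<notin> G \<and> sum c G + c i \<le> B}"

definition saturated :: "real \<Rightarrow> nat set \<Rightarrow> bool" where
  "saturated \<theta> G \<longleftrightarrow>
     (\<forall>u<n. u \<notin> G \<longrightarrow> sum c G + c u \<le> B \<longrightarrow> F (insert u G) - F G \<le> \<theta> * c u)"

text \<open>A larger set has smaller marginals and leaves fewer elements that fit.\<close>

lemma saturated_mono:
  assumes "saturated \<theta> G" "G \<subseteq> H" "H \<subseteq> {..<n}"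
  shows "saturated \<theta> H"
  unfolding saturated_def
proof (intro allI impI)
  fix u assume u: "u < n" "u \<notin> H" "sum c H + c u \<le> B"
  then have "F (insert u G) - F G \<le> \<theta> * c u"
    using assms cost_mono[of G H] by (auto simp: saturated_def)
  then show "F (insert u H) - F H \<le> \<theta> * c u"
    using marginal_antimono[of G H u] assms u by linarith
qed

lemma insert_in_candidates:
  "i < n \<Longrightarrow> sum c G + c i \<le> B \<Longrightarrow> insert i G \<in> candidates G"
  by (cases "i \<in> G") (auto simp: candidates_def insert_absorb)

text \<open>
  Let \<open>x\<close> be a costliest element of the optimum and \<open>D = B - c x\<close>. If \<open>D\<close> is not small, take \<open>W = D\<close>:
  as long as \<open>G\<close> costs at most \<open>D\<close>, every element of the optimum still fits. If \<open>D < B / m\<close>, then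
  either \<open>x\<close> alone is good or the cheap remainder has half of the value, and it fits until \<open>G\<close>
  costs \<open>W = B - D\<close>.
\<close>

lemma obtain_window:
  fixes m :: nat
  assumes opt: "smk_optimal {..<n} F c B Opt" and Opt_pos: "0 < F Opt" and m: "2 \<le> m"
    and V: "V \<le> 5 * F Opt" and target: "\<kappa> = (1/2 - 6 / real m) * F Opt"
  obtains W where "B / real m \<le> W" "W \<le> B"
    "\<And>G G' \<theta>. G' \<subseteq> G \<Longrightarrow> G \<subseteq> {..<n} \<Longrightarrow> sum c G \<le> W \<Longrightarrow>
       real m * (F G - F G') \<le> V \<Longrightarrow> saturated \<theta> G \<Longrightarrow> 0 \<le> \<theta> \<Longrightarrow> \<theta> < F Opt / (2 * W) \<Longrightarrow>
       \<exists>T \<in> candidates G' \<union> candidates {}. \<kappa> \<le> F T"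
proof -
  have sub: "Opt \<subseteq> {..<n}" and costO: "sum c Opt \<le> B"
    using opt by (auto simp: smk_optimal_def smk_feasible_def)
  have finO: "finite Opt" using sub finite_subset by blast
  \<comment> \<open>Of the slack \<open>6 * r\<close> in \<open>\<kappa>\<close>, five parts pay for
    the gain made since the last search for additions, where \<open>V \<le> 5 * F Opt\<close>
    enters, and one part pays for the cheap remainder \<open>R\<close> when
    \<open>D < B / m\<close>.\<close>
  define r where "r = F Opt / real m"
  have close: "F G - F G' \<le> 5 * r" if "real m * (F G - F G') \<le> V" for G G'
    using that V m by (simp add: r_def field_simps)
  have "0 \<le> r" using Opt_pos by (simp add: r_def)
  moreover have \<kappa>_eq: "\<kappa> = F Opt / 2 - 6 * r"
    using target by (simp add: r_def algebra_simps)
  ultimately have \<kappa>_le: "\<kappa> \<le> F Opt / 2 - 5 * r" "\<kappa> \<le> F Opt / 2" by linarith+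
  show ?thesis
  proof (cases "Opt = {}")
    case True
    show ?thesis
    proof (rule that[of B])
      show "B / real m \<le> B" using B_pos m by (simp add: field_simps)
      show "\<exists>T \<in> candidates G' \<union> candidates {}. \<kappa> \<le> F T" for G'
        using True \<kappa>_le Opt_pos by (intro bexI[of _ "{}"]) (auto simp: candidates_def)
    qed simp
  next
    case False
    obtain x where x: "x \<in> Opt" and xmax: "\<And>u. u \<in> Opt \<Longrightarrow> c u \<le> c x"
    proof -
      have "Max (c ` Opt) \<in> c ` Opt" using False finO by (intro Max_in) auto
      then obtain x where "x \<in> Opt" "c x = Max (c ` Opt)" by auto
      then show ?thesis using finO by (intro that[of x]) auto
    qed
    define D where "D = B - c x"
    define R where "R = Opt - {x}"
    have xn: "x < n" using x sub by auto
    have O_eq: "Opt = insert x R" "x \<notin> R" "finite R" "R \<subseteq> {..<n}"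
      using x finO sub by (auto simp: R_def)
    have costR: "sum c R \<le> D" using costO O_eq by (simp add: D_def)
    have D0: "0 \<le> D" using costR cost_nonneg[of R] O_eq by linarith
    have uD: "c u \<le> D" if "u \<in> R" for u
      using cost_mono[of "{u}" R] that costR O_eq by auto
    have DB: "D \<le> B" using c_nonneg[OF xn] by (simp add: D_def)
    show ?thesis
    proof (cases "B / real m \<le> D")
      case True
      have "0 < B / real m" using B_pos m by simp
      then have "0 < D" using True by linarith
      show ?thesis
      proof (rule that[OF True DB])
        fix G G' \<theta>
        assume G: "G' \<subseteq> G" "G \<subseteq> {..<n}" "sum c G \<le> D" "real m * (F G - F G') \<le> V"
          "saturated \<theta> G" "0 \<le> \<theta>" "\<theta> < F Opt / (2 * D)"
        \<comment> \<open>First \<open>x\<close> is added, then \<open>R\<close>. The latter gains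
          at most \<open>\<theta> * D\<close>, less than half of the optimum, so
          \<open>insert x G\<close> already has the other half.\<close>
        have "F Opt \<le> F (insert x G \<union> R)" using G O_eq xn by (intro F_mono) auto
        also have "\<dots> \<le> F (insert x G) + \<theta> * D"
        proof (rule F_Un_le_density)
          fix u assume u: "u \<in> R" "u \<notin> insert x G"
          then have "F (insert u G) - F G \<le> \<theta> * c u"
            using G(3,5) xmax[of u] O_eq by (auto simp: saturated_def D_def)
          moreover have "F (insert u (insert x G)) - F (insert x G) \<le> F (insert u G) - F G"
            using G u O_eq xn by (intro marginal_antimono) auto
          ultimately show "F (insert u (insert x G)) - F (insert x G) \<le> \<theta> * c u"
            by linarith
        qed (use G O_eq xn costR in auto)
        also have "\<theta> * D \<le> F Opt / 2" using G(7) \<open>0 < D\<close> by (simp add: field_simps)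
        finally have "F Opt / 2 \<le> F (insert x G)" by simp
        \<comment> \<open>The search was made at the older set \<open>G'\<close>, where
          \<open>x\<close> gains at least as much; only the difference \<open>F G - F G'\<close> is
          lost.\<close>
        moreover have "F (insert x G) - F G \<le> F (insert x G') - F G'"
          using G xn by (intro marginal_antimono) auto
        ultimately have "\<kappa> \<le> F (insert x G')"
          using close[OF G(4)] \<kappa>_le by linarith
        moreover have "insert x G' \<in> candidates G'"
          using cost_mono[of G' G] G xn by (intro insert_in_candidates) (auto simp: D_def)
        ultimately show "\<exists>T \<in> candidates G' \<union> candidates {}. \<kappa> \<le> F T" by auto
      qed
    next
      case False
      have W: "B * (1 - 1 / real m) \<le> B - D" using False by (simp add: field_simps)
      have "B / real m \<le> B * (1 - 1 / real m)" using B_pos m by (simp add: field_simps)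
      then have W': "B / real m \<le> B - D" using W by linarith
      show ?thesis
      proof (rule that[OF W'])
        show "B - D \<le> B" using D0 by simp
        fix G G' \<theta>
        assume G: "G' \<subseteq> G" "G \<subseteq> {..<n}" "sum c G \<le> B - D" "real m * (F G - F G') \<le> V"
          "saturated \<theta> G" "0 \<le> \<theta>" "\<theta> < F Opt / (2 * (B - D))"
        show "\<exists>T \<in> candidates G' \<union> candidates {}. \<kappa> \<le> F T"
        proof (cases "\<kappa> \<le> F {x}")
          case True
          have "insert x {} \<in> candidates {}"
            using xn DB D0 by (intro insert_in_candidates) (auto simp: D_def)
          then show ?thesis using True by auto
        next
          case small: False
          have "F Opt \<le> F {x} + F R" using F_Un_le[of "{x}" R] O_eq xn by simp
          then have "F Opt / 2 \<le> F R" using small \<kappa>_le(2) by linarith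
          also have "F R \<le> F (G \<union> R)" using G O_eq by (intro F_mono) auto
          also have "\<dots> \<le> F G + \<theta> * D"
          proof (rule F_Un_le_density)
            show "F (insert u G) - F G \<le> \<theta> * c u" if "u \<in> R" "u \<notin> G" for u
              using that G(3,5) uD[of u] O_eq by (auto simp: saturated_def)
          qed (use G O_eq costR in auto)
          also have "\<theta> * D \<le> r"
          proof -
            \<comment> \<open>Since \<open>m \<ge> 2\<close>, the window has at least half of the
              budget, hence \<open>\<theta> * B \<le> F Opt\<close>; now \<open>D < B / m\<close>
              gives the bound \<open>r\<close>.\<close>
            have "B / 2 \<le> B * (1 - 1 / real m)" using m B_pos by (simp add: field_simps)
            then have BD: "B / 2 \<le> B - D" using W by linarith
            have "\<theta> * (B - D) \<le> F Opt / 2" using G(7) BD B_pos by (simp add: field_simps)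
            moreover have "\<theta> * (B / 2) \<le> \<theta> * (B - D)" using BD G(6) by (rule mult_left_mono)
            ultimately have "\<theta> * B \<le> F Opt" by simp
            then have "\<theta> * B / real m \<le> F Opt / real m" by (intro divide_right_mono) auto
            moreover have "\<theta> * D \<le> \<theta> * (B / real m)" using False G(6) by (intro mult_left_mono) auto
            ultimately show ?thesis by (simp add: r_def)
          qed
          finally have "F Opt / 2 - r \<le> F G" by simp
          then have "\<kappa> \<le> F G'"
            using close[OF G(4)] \<kappa>_eq by linarith
          then show ?thesis by (auto simp: candidates_def)
        qed
      qed
    qed
  qed
qed

section \<open>A single greedy scan with a density threshold\<close>

context
  fixes m :: nat and V :: real
begin

fun grow :: "real \<Rightarrow> nat set \<Rightarrow> nat \<Rightarrow> nat set" where
  "grow \<tau> G\<^sub>0 0 = G\<^sub>0"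
| "grow \<tau> G\<^sub>0 (Suc j) = (let G = grow \<tau> G\<^sub>0 j in
     if j \<notin> G \<and> sum c G + c j \<le> B \<and> real m * (F G - F G\<^sub>0) < V \<and>
        \<tau> * c j \<le> F (insert j G) - F G
     then insert j G else G)"

lemma grow_superset: "G\<^sub>0 \<subseteq> grow \<tau> G\<^sub>0 j"
  by (induction j) (auto simp: Let_def)

lemma grow_mono: "i \<le> j \<Longrightarrow> grow \<tau> G\<^sub>0 i \<subseteq> grow \<tau> G\<^sub>0 j"
  by (induction j) (auto simp: Let_def le_Suc_eq)

lemma grow_feasible:
  assumes "feasible G\<^sub>0" "j \<le> n"
  shows "feasible (grow \<tau> G\<^sub>0 j)"
  using assms(2)
proof (induction j)
  case 0
  then show ?case using assms(1) by simp
next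
  case (Suc j)
  let ?G = "grow \<tau> G\<^sub>0 j"
  have "feasible ?G" using Suc by simp
  moreover from this have "finite ?G" by (auto simp: smk_feasible_def intro: finite_subset)
  ultimately show ?case using Suc.prems by (auto simp: Let_def smk_feasible_def)
qed

text \<open>A scan that never reaches its gain limit tests every element in full. An outside element
  that fits at the end already fitted at its turn, so its density was too low then, and marginals
  only fall afterwards.\<close>

lemma grow_saturated:
  assumes "feasible G\<^sub>0" "real m * (F (grow \<tau> G\<^sub>0 n) - F G\<^sub>0) < V"
  shows "saturated \<tau> (grow \<tau> G\<^sub>0 n)"
  unfolding saturated_def
proof (intro allI impI)
  let ?H = "grow \<tau> G\<^sub>0 n"
  fix u assume u: "u < n" "u \<notin> ?H" "sum c ?H + c u \<le> B"
  let ?G = "grow \<tau> G\<^sub>0 u"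
  have H: "?H \<subseteq> {..<n}" using grow_feasible[OF assms(1), of n \<tau>] by (simp add: smk_feasible_def)
  have GH: "?G \<subseteq> ?H" "grow \<tau> G\<^sub>0 (Suc u) \<subseteq> ?H" using u by (intro grow_mono; simp)+
  have "real m * (F ?G - F G\<^sub>0) \<le> real m * (F ?H - F G\<^sub>0)"
    using F_mono[OF GH(1) H] by (intro mult_left_mono) auto
  then have "real m * (F ?G - F G\<^sub>0) < V" using assms(2) by linarith
  moreover have "sum c ?G + c u \<le> B" using cost_mono[OF GH(1) H] u by linarith
  ultimately have "F (insert u ?G) - F ?G \<le> \<tau> * c u"
    using GH u(2) by (auto simp: Let_def split: if_splits)
  then show "F (insert u ?H) - F ?H \<le> \<tau> * c u"
    using marginal_antimono[OF GH(1) H u(1)] by linarith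
qed

text \<open>While the cost is at most \<open>W\<close>, each accepted element has density at least
  \<open>\<tau> \<ge> \<rho>\<close>. The \<open>min\<close> allows the last such element to
  overshoot \<open>W\<close>; from then on monotonicity is enough.\<close>

lemma grow_progress:
  assumes "feasible G\<^sub>0" "j \<le> n"
    and dense: "\<And>G. G\<^sub>0 \<subseteq> G \<Longrightarrow> G \<subseteq> {..<n} \<Longrightarrow> sum c G \<le> W \<Longrightarrow>
      real m * (F G - F G\<^sub>0) < V \<Longrightarrow> \<rho> \<le> \<tau>"
    and "0 \<le> \<rho>" and "\<rho> * min (sum c G\<^sub>0) W \<le> F G\<^sub>0"
  shows "\<rho> * min (sum c (grow \<tau> G\<^sub>0 j)) W \<le> F (grow \<tau> G\<^sub>0 j)"
  using \<open>j \<le> n\<close>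
proof (induction j)
  case 0
  then show ?case using assms by simp
next
  case (Suc j)
  let ?G = "grow \<tau> G\<^sub>0 j" and ?H = "grow \<tau> G\<^sub>0 (Suc j)"
  have IH: "\<rho> * min (sum c ?G) W \<le> F ?G" and jn: "j < n" using Suc by auto
  have G: "?G \<subseteq> {..<n}" using grow_feasible[OF assms(1), of j \<tau>] jn by (simp add: smk_feasible_def)
  have fin: "finite ?G" using G finite_subset by blast
  show ?case
  proof (cases "?H = ?G")
    case True
    then show ?thesis using IH by simp
  next
    case False
    then have H: "?H = insert j ?G" "j \<notin> ?G" "real m * (F ?G - F G\<^sub>0) < V"
      "\<tau> * c j \<le> F (insert j ?G) - F ?G"
      by (auto simp: Let_def split: if_splits)
    show ?thesis
    proof (cases "sum c ?G \<le> W")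
      case True
      have "\<rho> \<le> \<tau>" using dense[OF grow_superset G True H(3)] .
      then have "\<rho> * c j \<le> \<tau> * c j" using c_nonneg[OF jn] by (rule mult_right_mono)
      moreover have "\<rho> * sum c ?G \<le> F ?G" using IH True by (simp add: min_absorb1)
      moreover have "sum c ?H = sum c ?G + c j" unfolding H(1) using fin H(2) by simp
      ultimately have "\<rho> * sum c ?H \<le> F ?H"
        using H(4) unfolding H(1) by (simp add: distrib_left)
      moreover have "\<rho> * min (sum c ?H) W \<le> \<rho> * sum c ?H"
        using \<open>0 \<le> \<rho>\<close> by (intro mult_left_mono) auto
      ultimately show ?thesis by linarith
    next
      case False
      have "\<rho> * min (sum c ?H) W \<le> \<rho> * W" using \<open>0 \<le> \<rho>\<close> by (intro mult_left_mono) auto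
      also have "\<dots> \<le> F ?G" using IH False by simp
      also have "\<dots> \<le> F ?H" unfolding H(1) using G jn by (intro F_mono) auto
      finally show ?thesis .
    qed
  qed
qed

section \<open>Sequences of rounds and the approximation guarantee\<close>

definition threshold :: "nat \<Rightarrow> real" where
  "threshold l = V * real m / B * (1 - 1 / real m) ^ l"

text \<open>\<open>\<beta>\<close> is only asked to dominate the candidates seen so far, not to be
  their maximum, so the value recorded by the program can be inserted directly.\<close>

inductive reach :: "nat \<Rightarrow> nat set \<Rightarrow> real \<Rightarrow> real \<Rightarrow> bool" where
  start: "(\<And>T. T \<in> candidates {} \<Longrightarrow> F T \<le> \<beta>) \<Longrightarrow> reach 0 {} (V * real m / B) \<beta>"
| round: "reach k G \<tau> \<beta> \<Longrightarrow> H = grow \<tau> G n \<Longrightarrow>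
    \<tau>' = (if real m * (F H - F G) < V then \<tau> - \<tau> / real m else \<tau>) \<Longrightarrow>
    \<beta> \<le> \<beta>' \<Longrightarrow> (\<And>T. T \<in> candidates H \<Longrightarrow> F T \<le> \<beta>') \<Longrightarrow> reach (Suc k) H \<tau>' \<beta>'"

lemma reach_feasible: "reach k G \<tau> \<beta> \<Longrightarrow> feasible G"
  by (induction rule: reach.induct) (use B_pos in \<open>auto simp: smk_feasible_def[of _ _ _ "{}"] grow_feasible\<close>)

lemma reach_candidates:
  "reach k G \<tau> \<beta> \<Longrightarrow> T \<in> candidates G \<union> candidates {} \<Longrightarrow> F T \<le> \<beta>"
  by (induction arbitrary: T rule: reach.induct) force+

text \<open>Every round either lowers the threshold or gains at least \<open>V / m\<close>.\<close>

lemma reach_threshold: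
  assumes "reach k G \<tau> \<beta>"
  shows "\<exists>b l. k = b + l \<and> \<tau> = threshold l \<and> real b * V \<le> real m * F G \<and>
    (\<forall>l'. l = Suc l' \<longrightarrow> saturated (threshold l') G)"
  using assms
proof (induction rule: reach.induct)
  case (start \<beta>)
  show ?case using F_nonneg[of "{}"]
    by (intro exI[of _ 0]) (simp add: threshold_def)
next
  case (round k G \<tau> \<beta> H \<tau>' \<beta>')
  \<comment> \<open>\<open>b\<close> counts the rounds that gained at least \<open>V / m\<close>,
    \<open>l\<close> the reductions of the threshold.\<close>
  obtain b l where bl: "k = b + l" "\<tau> = threshold l" "real b * V \<le> real m * F G"
    "\<And>l'. l = Suc l' \<Longrightarrow> saturated (threshold l') G"
    using round.IH by auto
  have "feasible G" using round reach_feasible by blast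
  have GH: "G \<subseteq> H" "H \<subseteq> {..<n}"
    using grow_superset grow_feasible[OF \<open>feasible G\<close>, of n \<tau>] round by (auto simp: smk_feasible_def)
  show ?case
  proof (cases "real m * (F H - F G) < V")
    case True
    have "saturated (threshold l) H"
      using grow_saturated[OF \<open>feasible G\<close>, of \<tau>] True round(2) bl(2) by simp
    moreover have "\<tau>' = threshold (Suc l)"
      using round(3) True bl(2) by (simp add: threshold_def algebra_simps)
    moreover have "real b * V \<le> real m * F H"
      using bl(3) F_mono[OF GH] mult_left_mono[of "F G" "F H" "real m"] by linarith
    ultimately show ?thesis using bl(1) by (intro exI[of _ b] exI[of _ "Suc l"]) auto
  next
    case False
    then have "real (Suc b) * V \<le> real m * F H"
      using bl(3) by (simp add: algebra_simps)
    moreover have "\<tau>' = threshold l" using round(3) False bl(2) by simp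
    ultimately show ?thesis using bl saturated_mono[OF _ GH]
      by (intro exI[of _ "Suc b"] exI[of _ l]) auto
  qed
qed

text \<open>Suppose that no candidate reaches the target. As
  \<open>F G \<le> F Opt \<le> 2 * V\<close>, at most \<open>2 * m\<close> rounds gain
  \<open>V / m\<close>, so the threshold is lowered at least \<open>L + 1\<close> times. If
  \<open>G\<close> costs at most \<open>W\<close>, it is saturated at so small a threshold that the
  window yields a good candidate; otherwise \<open>G\<close> has outgrown \<open>W\<close> at
  density about \<open>F Opt / (2 * W)\<close>.\<close>

lemma reach_good:
  assumes opt: "smk_optimal {..<n} F c B Opt" and m: "2 \<le> m"
    and V: "F Opt \<le> 2 * V" "V \<le> 5 * F Opt"
    and L: "real m * (1 - 1 / real m) ^ L < 1 / 10"
    and reach: "reach (2 * m + Suc L) G \<tau> \<beta>"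
  shows "(1/2 - 6 / real m) * F Opt \<le> \<beta>"
proof (rule ccontr)
  define \<kappa> where "\<kappa> = (1/2 - 6 / real m) * F Opt"
  assume "\<not> ?thesis"
  then have \<beta>: "\<beta> < \<kappa>" by (simp add: \<kappa>_def)
  have feasG: "feasible G" using reach reach_feasible by blast
  have \<beta>0: "0 \<le> \<beta>"
    using reach_candidates[OF reach, of "{}"] F_nonneg[of "{}"] by (auto simp: candidates_def)
  have Opt_pos: "0 < F Opt"
  proof (rule ccontr)
    assume "\<not> 0 < F Opt"
    moreover have "0 \<le> F Opt"
      using opt by (auto simp: smk_optimal_def smk_feasible_def intro: F_nonneg)
    ultimately have "F Opt = 0" by simp
    then show False using \<beta> \<beta>0 by (simp add: \<kappa>_def)
  qed
  then have V_pos: "0 < V" using V by linarith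
  define q where "q = 1 - 1 / real m"
  have q: "0 < q" "q \<le> 1" using m by (auto simp: q_def)
  have thr: "threshold l = V * real m / B * q ^ l" for l by (simp add: threshold_def q_def)
  have thr0: "0 \<le> threshold l" for l using V_pos B_pos q by (simp add: thr)
  obtain W where W: "B / real m \<le> W" "W \<le> B" and window:
    "\<And>G G' \<theta>. G' \<subseteq> G \<Longrightarrow> G \<subseteq> {..<n} \<Longrightarrow> sum c G \<le> W \<Longrightarrow>
       real m * (F G - F G') \<le> V \<Longrightarrow> saturated \<theta> G \<Longrightarrow> 0 \<le> \<theta> \<Longrightarrow> \<theta> < F Opt / (2 * W) \<Longrightarrow>
       \<exists>T \<in> candidates G' \<union> candidates {}. \<kappa> \<le> F T"
    using obtain_window[OF opt Opt_pos m V(2) \<kappa>_def] by metis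
  have "0 < B / real m" using B_pos m by simp
  then have W_pos: "0 < W" using W by linarith
  \<comment> \<open>Saturation is known only for the previous threshold, which is the current one
    divided by \<open>q\<close>; hence the factor \<open>q\<close>.\<close>
  define \<rho> where "\<rho> = q * (F Opt / (2 * W))"
  have \<rho>0: "0 \<le> \<rho>" using q Opt_pos W_pos by (simp add: \<rho>_def)
  \<comment> \<open>Before the first reduction no saturation is known; there
    \<open>V \<ge> F Opt / 2\<close> and \<open>W \<ge> B / m\<close> make the initial threshold
    high enough.\<close>
  have start: "\<rho> \<le> threshold 0"
  proof -
    have "\<rho> \<le> 1 * (F Opt / (2 * W))"
      unfolding \<rho>_def using q Opt_pos W_pos by (intro mult_right_mono) auto
    also have "1 * (F Opt / (2 * W)) \<le> F Opt / (2 * (B / real m))"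
      unfolding mult_1 using W W_pos Opt_pos B_pos m by (intro divide_left_mono mult_left_mono mult_pos_pos) auto
    also have "\<dots> = F Opt / 2 * (real m / B)" by simp
    also have "\<dots> \<le> V * (real m / B)" using V B_pos by (intro mult_right_mono) auto
    finally show ?thesis by (simp add: thr)
  qed
  have progress: "\<rho> * min (sum c H) W \<le> F H" if "reach k H \<tau> \<beta>'" "\<beta>' < \<kappa>" for k H \<tau> \<beta>'
    using that
  proof (induction rule: reach.induct)
    case (start \<beta>')
    show ?case using W_pos F_nonneg[of "{}"] by simp
  next
    case (round k G \<tau> \<beta> H \<tau>' \<beta>')
    have feas: "feasible G" using round reach_feasible by blast
    have "\<rho> \<le> \<tau>" if G': "G \<subseteq> G'" "G' \<subseteq> {..<n}" "sum c G' \<le> W" "real m * (F G' - F G) < V" for G'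
    proof -
      obtain l where l: "\<tau> = threshold l" "\<And>l'. l = Suc l' \<Longrightarrow> saturated (threshold l') G"
        using reach_threshold[OF round(1)] by auto
      show ?thesis
      proof (cases l)
        case 0
        then show ?thesis using start l by simp
      next
        case (Suc l')
        have "saturated (threshold l') G'" using l(2)[OF Suc] G' saturated_mono by blast
        moreover have "\<not> (\<exists>T \<in> candidates G \<union> candidates {}. \<kappa> \<le> F T)"
          using reach_candidates[OF round(1)] round by fastforce
        \<comment> \<open>Contrapositive of the window property: all candidates of \<open>G\<close>
          and \<open>{}\<close> stay below \<open>\<kappa>\<close>.\<close>
        ultimately have "F Opt / (2 * W) \<le> threshold l'"
          using window[OF G'(1-3), of "threshold l'"] G'(4) thr0[of l'] by force
        then have "q * (F Opt / (2 * W)) \<le> q * threshold l'" using q by (intro mult_left_mono) auto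
        then show ?thesis using l Suc by (simp add: \<rho>_def thr mult_ac)
      qed
    qed
    then show ?case
      unfolding round(2) using round \<rho>0 feas by (intro grow_progress) auto
  qed
  obtain b l where bl: "2 * m + Suc L = b + l" "real b * V \<le> real m * F G"
    "\<And>l'. l = Suc l' \<Longrightarrow> saturated (threshold l') G"
    using reach_threshold[OF reach] by auto
  have "F G \<le> F Opt" using opt feasG by (auto simp: smk_optimal_def)
  then have "real m * F G \<le> real m * (2 * V)" using V by (intro mult_left_mono) auto
  then have "real b * V \<le> real (2 * m) * V" using bl(2) by simp
  then have "b \<le> 2 * m" using V_pos by (simp del: of_nat_mult)
  then obtain l' where l': "l = Suc l'" "L \<le> l'" using bl(1) by (cases l) auto
  have Gsub: "G \<subseteq> {..<n}" using feasG by (simp add: smk_feasible_def)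
  have G\<beta>: "F G \<le> \<beta>" using reach_candidates[OF reach, of G] by (simp add: candidates_def)
  show False
  proof (cases "sum c G \<le> W")
    case True
    \<comment> \<open>The 1/10 in the condition on \<open>L\<close> is what
      \<open>V \<le> 5 * F Opt\<close> calls for:
      \<open>V / (10 * B) \<le> F Opt / (2 * B)\<close>.\<close>
    have "threshold l' \<le> threshold L"
      unfolding thr using l' q V_pos B_pos by (intro mult_left_mono power_decreasing) auto
    also have "\<dots> = V / B * (real m * q ^ L)" by (simp add: thr)
    also have "\<dots> < V / B * (1 / 10)"
      using L V_pos B_pos by (intro mult_strict_left_mono) (auto simp: q_def)
    also have "\<dots> \<le> F Opt / (2 * B)" using V B_pos by (simp add: field_simps)
    also have "\<dots> \<le> F Opt / (2 * W)" using W W_pos Opt_pos by (simp add: frac_le)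
    finally have "threshold l' < F Opt / (2 * W)" .
    then show False
      using window[of G G "threshold l'"] Gsub True V_pos bl(3)[OF l'(1)] thr0[of l']
        reach_candidates[OF reach] \<beta> by force
  next
    case False
    then have "\<rho> * W \<le> \<beta>" using progress[OF reach \<beta>] G\<beta> by simp
    moreover have "\<rho> * W = q * F Opt / 2" using W_pos by (simp add: \<rho>_def)
    \<comment> \<open>The factor \<open>q\<close> loses only a fraction \<open>1 / (2 * m)\<close>
      of the optimum, less than the allowed \<open>6 / m\<close>.\<close>
    moreover have "\<kappa> \<le> q * F Opt / 2"
      using Opt_pos m by (simp add: \<kappa>_def q_def field_simps)
    ultimately show False using \<beta> by linarith
  qed
qed

end

end

section \<open>Time-bounded reasoning on the machine\<close>

fun loop_free :: "com \<Rightarrow> bool" where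
  "loop_free (Seq p q) \<longleftrightarrow> loop_free p \<and> loop_free q"
| "loop_free (If b p q) \<longleftrightarrow> loop_free p \<and> loop_free q"
| "loop_free (While b p) \<longleftrightarrow> False"
| "loop_free _ \<longleftrightarrow> True"

fun run :: "nat \<Rightarrow> (nat set \<Rightarrow> real) \<Rightarrow> com \<Rightarrow> state \<Rightarrow> state" where
  "run n F (NAssign x e) s = s\<lparr>nvar := (nvar s)(x := nval e s)\<rparr>"
| "run n F (RAssign x e) s = s\<lparr>rvar := (rvar s)(x := rval e s)\<rparr>"
| "run n F (NStore a i e) s = s\<lparr>narr := (narr s)(a := (narr s a)(nval i s := nval e s))\<rparr>"
| "run n F (RStore a i e) s = s\<lparr>rarr := (rarr s)(a := (rarr s a)(nval i s := rval e s))\<rparr>"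
| "run n F (Query x a) s = s\<lparr>rvar := (rvar s)(x := F (array_set n s a))\<rparr>"
| "run n F (Seq p q) s = run n F q (run n F p s)"
| "run n F (If b p q) s = (if bval b s then run n F p s else run n F q s)"
| "run n F _ s = s"

fun max_time :: "com \<Rightarrow> nat" where
  "max_time (NAssign x e) = 1 + ntime e"
| "max_time (RAssign x e) = 1 + rtime e"
| "max_time (NStore a i e) = 1 + ntime i + ntime e"
| "max_time (RStore a i e) = 1 + ntime i + rtime e"
| "max_time (Seq p q) = max_time p + max_time q"
| "max_time (If b p q) = btime b + max_time p + max_time q"
| "max_time _ = 1"

definition halts_within ::
    "nat \<Rightarrow> (nat set \<Rightarrow> real) \<Rightarrow> com \<Rightarrow> state \<Rightarrow> nat \<Rightarrow> (state \<Rightarrow> bool) \<Rightarrow> bool" where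
  "halts_within n F p s T Q \<longleftrightarrow> (\<exists>t s'. exec n F p s t s' \<and> t \<le> T \<and> Q s')"

text \<open>Straight-line code is executed by the recursive function \<open>run\<close>, so such
  goals reduce to simplification. \<open>max_time\<close> charges both branches of a conditional and
  is therefore an upper bound.\<close>

lemma halts_loop_free:
  assumes "loop_free p" "max_time p \<le> T" "Q (run n F p s)"
  shows "halts_within n F p s T Q"
proof -
  have "\<exists>t\<le>max_time p. exec n F p s t (run n F p s)"
    using assms(1)
  proof (induction p arbitrary: s)
    case (Seq p q)
    then obtain t t' where "t \<le> max_time p" "exec n F p s t (run n F p s)"
      "t' \<le> max_time q" "exec n F q (run n F p s) t' (run n F q (run n F p s))"
      by (metis loop_free.simps(1))
    then show ?case by (intro exI[of _ "t + t'"]) (auto intro: exec.Seq)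
  next
    case (If b p q)
    show ?case
    proof (cases "bval b s")
      case True
      obtain t where "t \<le> max_time p" "exec n F p s t (run n F p s)" using If by auto
      then show ?thesis using True by (intro exI[of _ "btime b + t"]) (auto intro: exec.IfTrue)
    next
      case False
      obtain t where "t \<le> max_time q" "exec n F q s t (run n F q s)" using If by auto
      then show ?thesis using False by (intro exI[of _ "btime b + t"]) (auto intro: exec.IfFalse)
    qed
  qed (simp_all only: loop_free.simps run.simps max_time.simps,
      (blast intro: exec.intros order_refl)+)
  then show ?thesis using assms(2,3) by (auto simp: halts_within_def intro: order_trans)
qed

lemma halts_Seq:
  assumes "halts_within n F p s T R" "\<And>s'. R s' \<Longrightarrow> halts_within n F q s' T' Q" "T + T' \<le> U"
  shows "halts_within n F (Seq p q) s U Q"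
  using assms unfolding halts_within_def by (meson add_mono exec.Seq order_trans)

lemma halts_weaken:
  "halts_within n F p s T Q \<Longrightarrow> T \<le> U \<Longrightarrow> (\<And>s'. Q s' \<Longrightarrow> R s') \<Longrightarrow> halts_within n F p s U R"
  by (auto simp: halts_within_def intro: order_trans)

definition For :: "nat \<Rightarrow> nexp \<Rightarrow> com \<Rightarrow> com" where
  "For x e p = Seq (NAssign x (NLit 0))
     (While (NLess (NVar x) e) (Seq p (NAssign x (NAdd (NVar x) (NLit 1)))))"

text \<open>Per iteration the test costs \<open>ntime e + 2\<close> and the increment 4; the initial
  assignment costs 2 and the final test \<open>ntime e + 2\<close>. The invariant \<open>I j\<close>
  refers to the state whose counter is already \<open>j\<close>.\<close>

lemma halts_For:
  assumes init: "I 0 (s\<lparr>nvar := (nvar s)(x := 0)\<rparr>)"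
    and bound: "\<And>j s. I j s \<Longrightarrow> nval e s = k"
    and body: "\<And>j s. I j s \<Longrightarrow> nvar s x = j \<Longrightarrow> j < k \<Longrightarrow>
      halts_within n F p s T (\<lambda>s'. nvar s' x = j \<and> I (Suc j) (s'\<lparr>nvar := (nvar s')(x := Suc j)\<rparr>))"
    and U: "k * (T + ntime e + 6) + ntime e + 4 \<le> U"
  shows "halts_within n F (For x e p) s U (I k)"
proof -
  let ?w = "While (NLess (NVar x) e) (Seq p (NAssign x (NAdd (NVar x) (NLit 1))))"
  have loop: "halts_within n F ?w s (d * (T + ntime e + 6) + ntime e + 2) (I k)"
    if "I j s" "nvar s x = j" "j + d = k" for d j s
    using that
  proof (induction d arbitrary: j s)
    case 0
    then have "exec n F ?w s (btime (NLess (NVar x) e)) s"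
      using bound by (intro exec.WhileFalse) auto
    then show ?case using 0 unfolding halts_within_def by (intro exI[of _ "ntime e + 2"] exI[of _ s]) auto
  next
    case (Suc d)
    obtain t s' where 1: "exec n F p s t s'" "t \<le> T" "nvar s' x = j"
      "I (Suc j) (s'\<lparr>nvar := (nvar s')(x := Suc j)\<rparr>)"
      using body[of j s] Suc.prems unfolding halts_within_def by auto
    let ?s = "s'\<lparr>nvar := (nvar s')(x := Suc j)\<rparr>"
    obtain t' s'' where 2: "exec n F ?w ?s t' s''" "t' \<le> d * (T + ntime e + 6) + ntime e + 2" "I k s''"
      using Suc.IH[of "Suc j" ?s] 1 Suc.prems unfolding halts_within_def by auto
    have "exec n F (NAssign x (NAdd (NVar x) (NLit 1))) s' 4 ?s"
      using exec.NAssign[of n F x "NAdd (NVar x) (NLit 1)" s'] 1(3) by (simp add: numeral_eq_Suc)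
    then have "exec n F (Seq p (NAssign x (NAdd (NVar x) (NLit 1)))) s (t + 4) ?s"
      using 1 by (intro exec.Seq)
    moreover have "bval (NLess (NVar x) e) s" using bound[OF Suc.prems(1)] Suc.prems by simp
    ultimately have "exec n F ?w s (btime (NLess (NVar x) e) + (t + 4) + t') s''"
      using 2(1) by (intro exec.WhileTrue)
    then show ?case unfolding halts_within_def
      using 1(2) 2 by (intro exI conjI) auto
  qed
  have "exec n F (NAssign x (NLit 0)) s 2 (s\<lparr>nvar := (nvar s)(x := 0)\<rparr>)"
    using exec.NAssign[of n F x "NLit 0" s] by (simp add: numeral_eq_Suc)
  then have "halts_within n F (NAssign x (NLit 0)) s 2 (\<lambda>s'. s' = s\<lparr>nvar := (nvar s)(x := 0)\<rparr>)"
    unfolding halts_within_def by blast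
  then show ?thesis unfolding For_def
    by (rule halts_Seq[where T' = "k * (T + ntime e + 6) + ntime e + 2"])
      (use loop[of 0 _ k] init U in auto)
qed

text \<open>Working on bare array contents turns a store into a function update that
  \<open>support_upd\<close> can rewrite.\<close>

definition support :: "nat \<Rightarrow> (nat \<Rightarrow> nat) \<Rightarrow> nat set" where
  "support n h = {i. i < n \<and> h i \<noteq> 0}"

lemma array_set_support: "array_set n s a = support n (narr s a)"
  by (simp add: array_set_def support_def)

lemma support_upd:
  "support n (h(i := v)) = (if v \<noteq> 0 \<and> i < n then insert i (support n h) else support n h - {i})"
  by (auto simp: support_def)

lemma eq_0_iff_notin_support: "i < n \<Longrightarrow> h i = 0 \<longleftrightarrow> i \<notin> support n h"
  by (simp add: support_def)

section \<open>The program\<close>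

text \<open>
  Natural variables: 0 ground set size, 1 scan index, 2 round counter, 3 best
  single addition. Real variables: 0 budget, 2 estimate \<open>V\<close>, 3 last query, 4 threshold, 5 and 6 value
  and cost of the greedy set \<open>G\<close>, 7 value of \<open>G\<close> at the start of the round, 8 best value of the
  current max-scan, 9 value of the best recorded set. Natural arrays: 0 best recorded set, 1 greedy
  set \<open>G\<close>, 2 estimation set.
\<close>

definition estimate_body :: com where
  "estimate_body =
     If (BNot (RLess (RVar 0) (RArr 0 (NVar 1))))
       (Seq (NStore 2 (NVar 1) (NLit 1))
       (Seq (Query 3 2)
         (If (RLess (RMul (RVar 0) (RSub (RVar 3) (RVar 2))) (RMul (RArr 0 (NVar 1)) (RVar 2)))
           (NStore 2 (NVar 1) (NLit 0))
           (RAssign 2 (RVar 3)))))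
       Skip"

definition estimate_prog :: com where
  "estimate_prog = Seq (Query 2 2) (For 1 (NVar 0) estimate_body)"

definition init_prog :: "nat \<Rightarrow> com" where
  "init_prog m = Seq (RAssign 4 (RDiv (RMul (RVar 2) (RLit m)) (RVar 0))) (Query 5 1)"

text \<open>The oracle sees only sets held in arrays, so an addition is tried by storing it in
  \<open>G\<close>, querying, and removing it again.\<close>

definition max_body :: com where
  "max_body =
     If (BAnd (NLess (NArr 1 (NVar 1)) (NLit 1))
          (BNot (RLess (RVar 0) (RAdd (RVar 6) (RArr 0 (NVar 1))))))
       (Seq (NStore 1 (NVar 1) (NLit 1))
       (Seq (Query 3 1)
       (Seq (NStore 1 (NVar 1) (NLit 0))
         (If (RLess (RVar 8) (RVar 3))
           (Seq (RAssign 8 (RVar 3)) (NAssign 3 (NVar 1)))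
           Skip))))
       Skip"

text \<open>Copying takes linear time, so it is done once after the search and not at every
  improvement; the test makes it idle when nothing better was found.\<close>

definition copy_body :: com where
  "copy_body = If (RLess (RVar 9) (RVar 8)) (NStore 0 (NVar 1) (NArr 1 (NVar 1))) Skip"

text \<open>
  The index \<open>n\<close> in variable 3 stands for ``no addition'': storing there does not affect the set
  held in the array.
\<close>

definition max_prog :: com where
  "max_prog =
     Seq (Seq (RAssign 8 (RVar 5)) (NAssign 3 (NVar 0)))
    (Seq (For 1 (NVar 0) max_body)
    (Seq (For 1 (NVar 0) copy_body)
      (If (RLess (RVar 9) (RVar 8))
        (Seq (NStore 0 (NVar 3) (NLit 1)) (RAssign 9 (RVar 8)))
        Skip)))"

definition grow_body :: "nat \<Rightarrow> com" where
  "grow_body m =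
     If (BAnd (NLess (NArr 1 (NVar 1)) (NLit 1))
        (BAnd (BNot (RLess (RVar 0) (RAdd (RVar 6) (RArr 0 (NVar 1)))))
          (RLess (RMul (RLit m) (RSub (RVar 5) (RVar 7))) (RVar 2))))
       (Seq (NStore 1 (NVar 1) (NLit 1))
       (Seq (Query 3 1)
         (If (RLess (RSub (RVar 3) (RVar 5)) (RMul (RVar 4) (RArr 0 (NVar 1))))
           (NStore 1 (NVar 1) (NLit 0))
           (Seq (RAssign 5 (RVar 3)) (RAssign 6 (RAdd (RVar 6) (RArr 0 (NVar 1))))))))
       Skip"

definition grow_prog :: "nat \<Rightarrow> com" where
  "grow_prog m =
     Seq (RAssign 7 (RVar 5))
    (Seq (For 1 (NVar 0) (grow_body m))
      (If (RLess (RMul (RLit m) (RSub (RVar 5) (RVar 7))) (RVar 2))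
        (RAssign 4 (RSub (RVar 4) (RDiv (RVar 4) (RLit m))))
        Skip))"

text \<open>\<open>m\<close> and the number \<open>K\<close> of rounds are literals of the program,
  since the machine has no rounding with which to compute them from the accuracy.\<close>

definition smk_prog :: "nat \<Rightarrow> nat \<Rightarrow> com" where
  "smk_prog m K =
     Seq estimate_prog
    (Seq (init_prog m)
    (Seq max_prog
      (For 2 (NLit K) (Seq (grow_prog m) max_prog))))"

context smk
begin

definition input_ok :: "state \<Rightarrow> bool" where
  "input_ok s \<longleftrightarrow> nvar s 0 = n \<and> rvar s 0 = B \<and> (\<forall>i<n. rarr s 0 i = c i)"

definition memory :: "state \<Rightarrow> nat \<Rightarrow> real \<Rightarrow> real \<Rightarrow> nat set \<Rightarrow> nat set \<Rightarrow> real \<Rightarrow> bool" where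
  "memory s k V \<tau> G S \<beta> \<longleftrightarrow> input_ok s \<and> nvar s 2 = k \<and> rvar s 2 = V \<and> rvar s 4 = \<tau> \<and>
     rvar s 5 = F G \<and> rvar s 6 = sum c G \<and> rvar s 9 = \<beta> \<and>
     array_set n s 1 = G \<and> array_set n s 0 = S"

lemmas memory_simps = memory_def input_ok_def array_set_support support_upd eq_0_iff_notin_support

lemma halts_estimate:
  assumes s: "input_ok s" "array_set n s 0 = {}" "array_set n s 1 = {}" "array_set n s 2 = {}"
    "rvar s 6 = 0" "rvar s 9 = 0"
  shows "halts_within n F estimate_prog s (100 * n + 10)
    (\<lambda>s'. input_ok s' \<and> rvar s' 2 = F (estimate_set n) \<and> array_set n s' 0 = {} \<and>
      array_set n s' 1 = {} \<and> rvar s' 6 = 0 \<and> rvar s' 9 = 0)"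
proof -
  define I where "I = (\<lambda>j s. input_ok s \<and> rvar s 2 = F (estimate_set j) \<and> array_set n s 0 = {} \<and>
      array_set n s 1 = {} \<and> array_set n s 2 = estimate_set j \<and> rvar s 6 = 0 \<and> rvar s 9 = 0)"
  have loop: "halts_within n F (For 1 (NVar 0) estimate_body) s (100 * n + 5) (I n)"
    if "I 0 s" for s
  proof (rule halts_For[where k = n and T = 60])
    show "I 0 (s\<lparr>nvar := (nvar s)(1 := 0)\<rparr>)"
      using that by (simp add: I_def memory_simps)
    show "halts_within n F estimate_body s 60
        (\<lambda>s'. nvar s' 1 = j \<and> I (Suc j) (s'\<lparr>nvar := (nvar s')(1 := Suc j)\<rparr>))"
      if "I j s" "nvar s 1 = j" "j < n" for j s
    proof -
      \<comment> \<open>Hence storing 0 at \<open>j\<close> after a rejected trial restores the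
        set.\<close>
      have "j \<notin> estimate_set j" using estimate_set_subset[of j] by auto
      then show ?thesis using that
        by (intro halts_loop_free)
          (auto simp: estimate_body_def I_def memory_simps Let_def not_less not_le)
    qed
  qed (auto simp: I_def input_ok_def)
  show ?thesis unfolding estimate_prog_def
  proof (rule halts_Seq[where T = 1 and R = "I 0" and T' = "100 * n + 5"])
    show "halts_within n F (Query 2 2) s 1 (I 0)"
      using s by (intro halts_loop_free) (auto simp: I_def memory_simps)
    show "halts_within n F (For 1 (NVar 0) estimate_body) s' (100 * n + 5) 
      (\<lambda>s'. input_ok s' \<and> rvar s' 2 = F (estimate_set n) \<and> array_set n s' 0 = {} \<and>
      array_set n s' 1 = {} \<and> rvar s' 6 = 0 \<and> rvar s' 9 = 0)" if "I 0 s'" for s'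
      using loop[OF that] by (auto simp: halts_within_def I_def)
  qed simp
qed

text \<open>The recorded value is only bounded by \<open>F S\<close>, not equal to it, because
  register 9 starts at 0 while \<open>F {}\<close> may be positive.\<close>

lemma halts_max:
  assumes s: "memory s k V \<tau> G S \<beta>" and S: "feasible S" "\<beta> \<le> F S" and G: "feasible G"
  shows "halts_within n F max_prog s (200 * n + 40) (\<lambda>s'. \<exists>S' \<beta>'. memory s' k V \<tau> G S' \<beta>' \<and>
    feasible S' \<and> \<beta>' \<le> F S' \<and> \<beta> \<le> \<beta>' \<and> (\<forall>T\<in>candidates G. F T \<le> \<beta>'))"
proof -
  define addition where "addition = (\<lambda>i v. i = n \<and> v = F G \<or>
    i < n \<and> i \<notin> G \<and> sum c G + c i \<le> B \<and> v = F (insert i G))"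
  define I where "I = (\<lambda>j s. memory s k V \<tau> G S \<beta> \<and> addition (nvar s 3) (rvar s 8) \<and>
    F G \<le> rvar s 8 \<and> (\<forall>i<j. i \<notin> G \<longrightarrow> sum c G + c i \<le> B \<longrightarrow> F (insert i G) \<le> rvar s 8))"
  have scan: "halts_within n F (For 1 (NVar 0) max_body) s (80 * n + 5) (I n)" if "I 0 s" for s
  proof (rule halts_For[where k = n and T = 60])
    show "I 0 (s\<lparr>nvar := (nvar s)(1 := 0)\<rparr>)"
      using that by (simp add: I_def memory_simps)
    show "halts_within n F max_body s 60
        (\<lambda>s'. nvar s' 1 = j \<and> I (Suc j) (s'\<lparr>nvar := (nvar s')(1 := Suc j)\<rparr>))"
      if "I j s" "nvar s 1 = j" "j < n" for j s
      using that
      by (intro halts_loop_free)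
        (auto simp: max_body_def I_def memory_simps addition_def less_Suc_eq not_less)
  qed (auto simp: I_def memory_def input_ok_def)
  \<comment> \<open>Without an improvement the loop leaves \<open>S\<close> untouched; otherwise
    only the first \<open>j\<close> entries are known to agree with \<open>G\<close>.\<close>
  define J where "J = (\<lambda>i v j s. \<exists>S'. memory s k V \<tau> G S' \<beta> \<and> nvar s 3 = i \<and> rvar s 8 = v \<and>
    (if \<beta> < v then \<forall>u<j. u \<in> S' \<longleftrightarrow> u \<in> G else S' = S))"
  have copy: "halts_within n F (For 1 (NVar 0) copy_body) s (80 * n + 5) (J i v n)" if "J i v 0 s" for i v s
  proof (rule halts_For[where k = n and T = 20])
    show "J i v 0 (s\<lparr>nvar := (nvar s)(1 := 0)\<rparr>)"
      using that by (auto simp: J_def memory_simps)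
    show "halts_within n F copy_body s 20
        (\<lambda>s'. nvar s' 1 = j \<and> J i v (Suc j) (s'\<lparr>nvar := (nvar s')(1 := Suc j)\<rparr>))"
      if "J i v j s" "nvar s 1 = j" "j < n" for j s
    proof -
      have "narr s 1 j \<noteq> 0 \<longleftrightarrow> j \<in> G" using that by (auto simp: J_def memory_simps)
      then show ?thesis using that
        by (intro halts_loop_free)
          (auto simp: copy_body_def J_def memory_simps less_Suc_eq)
    qed
  qed (auto simp: J_def memory_def input_ok_def)
  let ?fin = "If (RLess (RVar 9) (RVar 8)) (Seq (NStore 0 (NVar 3) (NLit 1)) (RAssign 9 (RVar 8))) Skip"
  let ?post = "\<lambda>s'. \<exists>S' \<beta>'. memory s' k V \<tau> G S' \<beta>' \<and>
    feasible S' \<and> \<beta>' \<le> F S' \<and> \<beta> \<le> \<beta>' \<and> (\<forall>T\<in>candidates G. F T \<le> \<beta>')"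
  have recorded: "halts_within n F ?fin s 20 ?post"
    if J: "J i v n s" and "addition i v" and best: "\<And>T. T \<in> candidates G \<Longrightarrow> F T \<le> v" for i v s
  proof -
    obtain S' where S': "memory s k V \<tau> G S' \<beta>" "nvar s 3 = i" "rvar s 8 = v"
      "if \<beta> < v then \<forall>u<n. u \<in> S' \<longleftrightarrow> u \<in> G else S' = S"
      using J by (auto simp: J_def)
    have sub: "S' \<subseteq> {..<n}" "G \<subseteq> {..<n}" using S'(1) by (auto simp: memory_def array_set_def)
    show ?thesis
    proof (cases "\<beta> < v")
      case True
      then have SG: "S' = G" using S'(4) sub by auto
      let ?T = "if i < n then insert i G else G"
      have "finite G" using sub finite_subset by blast
      then have T: "feasible ?T" "v = F ?T" using \<open>addition i v\<close> G
        by (auto simp: addition_def smk_feasible_def)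
      \<comment> \<open>A store outside \<open>{..<n}\<close> is rewritten by
        \<open>support_upd\<close> to a removal of \<open>i\<close>, which leaves \<open>G\<close>
        unchanged.\<close>
      have "G - {i} = G" if "\<not> i < n" using sub that by auto
      then have mem: "memory (run n F ?fin s) k V \<tau> G ?T v"
        using S'(1-3) SG True by (auto simp: memory_simps)
      have "?post (run n F ?fin s)"
        by (rule exI[of _ ?T], rule exI[of _ v]) (use mem T True best in auto)
      then show ?thesis by (intro halts_loop_free) auto
    next
      case False
      then have "memory (run n F ?fin s) k V \<tau> G S \<beta>"
        using S' by (simp add: memory_def)
      then show ?thesis using S False best
        by (intro halts_loop_free) (force simp del: run.simps)+
    qed
  qed
  show ?thesis unfolding max_prog_def
  proof (rule halts_Seq[where T = 4 and R = "I 0" and T' = "160 * n + 30"])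
    show "halts_within n F (Seq (RAssign 8 (RVar 5)) (NAssign 3 (NVar 0))) s 4 (I 0)"
      using s by (intro halts_loop_free) (auto simp: I_def memory_simps addition_def)
  next
    fix s assume "I 0 s"
    then show "halts_within n F (Seq (For 1 (NVar 0) max_body) (Seq (For 1 (NVar 0) copy_body) ?fin))
      s (160 * n + 30) ?post"
    proof (rule halts_Seq[OF scan, where T' = "80 * n + 25"])
      fix s assume I: "I n s"
      have J0: "J (nvar s 3) (rvar s 8) 0 s"
        using I by (auto simp: I_def J_def)
      have best: "F T \<le> rvar s 8" if "T \<in> candidates G" for T
        using that I by (auto simp: I_def candidates_def)
      show "halts_within n F (Seq (For 1 (NVar 0) copy_body) ?fin) s (80 * n + 25) ?post"
      proof (rule halts_Seq[OF copy[OF J0]])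
        show "halts_within n F ?fin s' 20 ?post" if "J (nvar s 3) (rvar s 8) n s'" for s'
          using recorded[OF that _ best] I by (auto simp: I_def)
      qed simp
    qed simp
  qed simp
qed

lemma halts_grow:
  fixes m :: nat
  assumes s: "memory s k V \<tau> G S \<beta>" and G: "feasible G"
  defines "H \<equiv> grow m V \<tau> G n"
  shows "halts_within n F (grow_prog m) s (100 * n + 40)
    (\<lambda>s'. memory s' k V (if real m * (F H - F G) < V then \<tau> - \<tau> / real m else \<tau>) H S \<beta>)"
proof -
  define I where "I = (\<lambda>j s. memory s k V \<tau> (grow m V \<tau> G j) S \<beta> \<and> rvar s 7 = F G)"
  have scan: "halts_within n F (For 1 (NVar 0) (grow_body m)) s (90 * n + 5) (I n)" if "I 0 s" for s
  proof (rule halts_For[where k = n and T = 80])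
    show "I 0 (s\<lparr>nvar := (nvar s)(1 := 0)\<rparr>)"
      using that by (simp add: I_def memory_simps)
    show "halts_within n F (grow_body m) s 80
        (\<lambda>s'. nvar s' 1 = j \<and> I (Suc j) (s'\<lparr>nvar := (nvar s')(1 := Suc j)\<rparr>))"
      if I: "I j s" and j: "nvar s 1 = j" "j < n" for j s
    proof -
      let ?G = "grow m V \<tau> G j"
      have "finite ?G" using grow_feasible[OF G, of j m V \<tau>] j
        by (auto simp: smk_feasible_def intro: finite_subset)
      then show ?thesis using I j
        by (intro halts_loop_free)
          (auto simp: grow_body_def I_def memory_simps Let_def not_less not_le)
    qed
  qed (auto simp: I_def memory_def input_ok_def)
  show ?thesis unfolding grow_prog_def
  proof (rule halts_Seq[where T = 2 and R = "I 0" and T' = "90 * n + 30"])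
    show "halts_within n F (RAssign 7 (RVar 5)) s 2 (I 0)"
      using s by (intro halts_loop_free) (auto simp: I_def memory_simps)
  next
    fix s assume "I 0 s"
    then show "halts_within n F
      (Seq (For 1 (NVar 0) (grow_body m))
        (If (RLess (RMul (RLit m) (RSub (RVar 5) (RVar 7))) (RVar 2))
          (RAssign 4 (RSub (RVar 4) (RDiv (RVar 4) (RLit m)))) Skip))
      s (90 * n + 30)
      (\<lambda>s'. memory s' k V (if real m * (F H - F G) < V then \<tau> - \<tau> / real m else \<tau>) H S \<beta>)"
    proof (rule halts_Seq[OF scan, where T' = 20])
      fix s assume "I n s"
      then show "halts_within n F
        (If (RLess (RMul (RLit m) (RSub (RVar 5) (RVar 7))) (RVar 2))
          (RAssign 4 (RSub (RVar 4) (RDiv (RVar 4) (RLit m)))) Skip) s 20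
        (\<lambda>s'. memory s' k V (if real m * (F H - F G) < V then \<tau> - \<tau> / real m else \<tau>) H S \<beta>)"
        by (intro halts_loop_free) (auto simp: I_def H_def memory_simps)
    qed simp
  qed simp
qed

text \<open>The invariant ties the memory after \<open>k\<close> rounds to \<open>reach\<close> with
  the same \<open>k\<close>, the recorded value serving as \<open>\<beta>\<close>. One estimate, one
  search for additions and \<open>K\<close> rounds take linear time each.\<close>

lemma halts_smk_prog:
  assumes s: "input_ok s" "\<And>a. array_set n s a = {}" "rvar s 6 = 0" "rvar s 9 = 0"
  shows "halts_within n F (smk_prog m K) s ((K + 1) * (400 * n + 200))
    (\<lambda>s'. feasible (array_set n s' 0) \<and>
      (\<exists>G \<tau> \<beta>. reach m (F (estimate_set n)) K G \<tau> \<beta> \<and> \<beta> \<le> F (array_set n s' 0)))"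
proof -
  define V where "V = F (estimate_set n)"
  have empty: "feasible {}" "0 \<le> F {}" using B_pos F_nonneg[of "{}"] by (auto simp: smk_feasible_def)
  define I where "I = (\<lambda>k s. \<exists>G S \<tau> \<beta>. memory s k V \<tau> G S \<beta> \<and> feasible S \<and> \<beta> \<le> F S \<and>
    reach m V k G \<tau> \<beta>)"
  have round: "halts_within n F (Seq (grow_prog m) max_prog) s (300 * n + 80)
      (\<lambda>s'. nvar s' 2 = k \<and> I (Suc k) (s'\<lparr>nvar := (nvar s')(2 := Suc k)\<rparr>))" if "I k s" for k s
  proof -
    obtain G S \<tau> \<beta> where st: "memory s k V \<tau> G S \<beta>" "feasible S" "\<beta> \<le> F S" "reach m V k G \<tau> \<beta>"
      using \<open>I k s\<close> by (auto simp: I_def)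
    have G: "feasible G" using reach_feasible[OF st(4)] .
    define H where "H = grow m V \<tau> G n"
    have H: "feasible H" using grow_feasible[OF G] by (simp add: H_def)
    define \<tau>' where "\<tau>' = (if real m * (F H - F G) < V then \<tau> - \<tau> / real m else \<tau>)"
    show ?thesis
    proof (rule halts_Seq[OF halts_grow[OF st(1) G, of m, folded H_def, folded \<tau>'_def]])
      fix s' assume "memory s' k V \<tau>' H S \<beta>"
      then show "halts_within n F max_prog s' (200 * n + 40)
        (\<lambda>s'. nvar s' 2 = k \<and> I (Suc k) (s'\<lparr>nvar := (nvar s')(2 := Suc k)\<rparr>))"
      proof (rule halts_weaken[OF halts_max[OF _ st(2,3) H]])
        fix s assume "\<exists>S' \<beta>'. memory s k V \<tau>' H S' \<beta>' \<and> feasible S' \<and> \<beta>' \<le> F S' \<and> \<beta> \<le> \<beta>' \<and>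
          (\<forall>T\<in>candidates H. F T \<le> \<beta>')"
        then obtain S' \<beta>' where S': "memory s k V \<tau>' H S' \<beta>'" "feasible S'" "\<beta>' \<le> F S'" "\<beta> \<le> \<beta>'"
          "\<forall>T\<in>candidates H. F T \<le> \<beta>'" by auto
        have "reach m V (Suc k) H \<tau>' \<beta>'"
          using reach.round[OF st(4) H_def \<tau>'_def S'(4)] S'(5) by auto
        moreover have "memory (s\<lparr>nvar := (nvar s)(2 := Suc k)\<rparr>) (Suc k) V \<tau>' H S' \<beta>'" "nvar s 2 = k"
          using S'(1) by (auto simp: memory_simps)
        ultimately show "nvar s 2 = k \<and> I (Suc k) (s\<lparr>nvar := (nvar s)(2 := Suc k)\<rparr>)"
          using S'(2,3) unfolding I_def by blast
      qed simp
    qed simp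
  qed
  have loop: "halts_within n F (For 2 (NLit K) (Seq (grow_prog m) max_prog)) s
      (K * (300 * n + 87) + 5) (I K)" if "I 0 (s\<lparr>nvar := (nvar s)(2 := 0)\<rparr>)" for s
    by (rule halts_For[where k = K and T = "300 * n + 80"]) (use that round in auto)
  let ?post = "\<lambda>s'. feasible (array_set n s' 0) \<and>
      (\<exists>G \<tau> \<beta>. reach m V K G \<tau> \<beta> \<and> \<beta> \<le> F (array_set n s' 0))"
  let ?est = "\<lambda>s'. input_ok s' \<and> rvar s' 2 = V \<and> array_set n s' 0 = {} \<and>
      array_set n s' 1 = {} \<and> rvar s' 6 = 0 \<and> rvar s' 9 = 0"
  have "halts_within n F (smk_prog m K) s ((K + 1) * (400 * n + 200)) ?post"
    unfolding smk_prog_def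
  proof (rule halts_Seq[where R = ?est and T = "100 * n + 10" and
        T' = "200 * n + 60 + (K * (300 * n + 87) + 5)"])
    show "halts_within n F estimate_prog s (100 * n + 10) ?est"
      using halts_estimate[of s] s by (simp add: V_def)
    show "halts_within n F (Seq (init_prog m) (Seq max_prog
        (For 2 (NLit K) (Seq (grow_prog m) max_prog)))) s (200 * n + 60 + (K * (300 * n + 87) + 5)) ?post"
      if est: "?est s" for s
    proof (rule halts_Seq[where R = "\<lambda>s'. memory s' (nvar s 2) V (V * real m / B) {} {} 0" and T = 10
          and T' = "200 * n + 45 + (K * (300 * n + 87) + 5)"])
      \<comment> \<open>The round counter is reset only when the loop starts, so until then it keeps
        whatever value it holds.\<close>
      show "halts_within n F (init_prog m) s 10 (\<lambda>s'. memory s' (nvar s 2) V (V * real m / B) {} {} 0)"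
        using est by (intro halts_loop_free) (auto simp: init_prog_def memory_simps)
      fix s' assume "memory s' (nvar s 2) V (V * real m / B) {} {} 0"
      from halts_max[OF this empty empty(1)]
      show "halts_within n F (Seq max_prog (For 2 (NLit K) (Seq (grow_prog m) max_prog))) s'
        (200 * n + 45 + (K * (300 * n + 87) + 5)) ?post"
      proof (rule halts_Seq[where T' = "K * (300 * n + 87) + 5"])
        fix s'' assume "\<exists>S' \<beta>'. memory s'' (nvar s 2) V (V * real m / B) {} S' \<beta>' \<and>
          feasible S' \<and> \<beta>' \<le> F S' \<and> 0 \<le> \<beta>' \<and> (\<forall>T\<in>candidates {}. F T \<le> \<beta>')"
        then obtain S' \<beta>' where S': "memory s'' (nvar s 2) V (V * real m / B) {} S' \<beta>'"
          "feasible S'" "\<beta>' \<le> F S'" "\<forall>T\<in>candidates {}. F T \<le> \<beta>'" by auto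
        have "memory (s''\<lparr>nvar := (nvar s'')(2 := 0)\<rparr>) 0 V (V * real m / B) {} S' \<beta>'"
          using S'(1) by (auto simp: memory_simps)
        moreover have "reach m V 0 {} (V * real m / B) \<beta>'" using S'(4) by (intro reach.start) auto
        ultimately have I0: "I 0 (s''\<lparr>nvar := (nvar s'')(2 := 0)\<rparr>)"
          using S'(2,3) unfolding I_def by blast
        show "halts_within n F (For 2 (NLit K) (Seq (grow_prog m) max_prog)) s''
          (K * (300 * n + 87) + 5) ?post"
          by (rule halts_weaken[OF loop[OF I0]]) (auto simp: I_def memory_def)
      qed simp
    qed simp
  qed (simp add: algebra_simps)
  then show ?thesis by (simp add: V_def)
qed

end

section \<open>Parameters and transfer to an enumerated ground set\<close>

text \<open>Keeps the logarithmic factor away from 0 for accuracies up to 1/2, so that it can absorb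
  constants.\<close>

lemma half_le_ln2: "1/2 \<le> ln (2 :: real)"
  using exp_half_le2 by (subst ln_ge_iff) auto

text \<open>\<open>m\<close> is about \<open>6 / \<epsilon>\<close> to limit the loss, and
  \<open>L\<close> about \<open>m * ln (10 * m)\<close>, because
  \<open>(1 - 1 / m) ^ L \<le> exp (- L / m)\<close>.\<close>

lemma smk_parameters:
  fixes \<epsilon> :: real
  assumes "0 < \<epsilon>" "\<epsilon> < 1/2"
  obtains m L :: nat where "2 \<le> m" "6 / real m \<le> \<epsilon>" "real m * (1 - 1 / real m) ^ L < 1 / 10"
    "real (2 * m + Suc L + 1) \<le> 88 * (1 / \<epsilon> * ln (1 / \<epsilon>))"
proof -
  define x where "x = 1 / \<epsilon>"
  have x: "2 < x" using assms by (simp add: x_def field_simps)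
  note half_le_ln2
  moreover have "ln 2 \<le> ln x" using x by simp
  ultimately have lx: "1/2 \<le> ln x" by linarith
  define m where "m = nat \<lceil>6 * x\<rceil>"
  have m: "6 * x \<le> real m" "real m \<le> 7 * x" using x unfolding m_def by linarith+
  have m2: "2 \<le> m" using m x by linarith
  define a where "a = ln (10 * real m)"
  have a0: "0 \<le> a" using m2 by (simp add: a_def)
  \<comment> \<open>\<open>10 * m \<le> 70 * x\<close>, with 70 rounded up to a power of two so that
    \<open>ln 2 \<le> ln x\<close> absorbs it.\<close>
  have "a \<le> ln (128 * x)" unfolding a_def using m x by simp
  also have "\<dots> = 7 * ln 2 + ln x" using x ln_realpow[of 2 7] by (simp add: ln_mult)
  finally have a: "a \<le> 8 * ln x" using \<open>ln 2 \<le> ln x\<close> by linarith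
  define L where "L = nat \<lceil>real m * a\<rceil> + 1"
  have "0 \<le> real m * a" using a0 by simp
  then have L: "real m * a < real L" "real L \<le> real m * a + 2" unfolding L_def by linarith+
  have "real m * a \<le> (7 * x) * (8 * ln x)" using m a a0 x by (intro mult_mono) auto
  \<comment> \<open>The 16 is 14 from \<open>2 * m \<le> 14 * x\<close> plus 2 from the additive
    constant 4, which is at most \<open>2 * x\<close>.\<close>
  then have "real (2 * m + Suc L + 1) \<le> 16 * x + 56 * (x * ln x)"
    using L m x by simp
  also have "16 * x \<le> 32 * (x * ln x)"
    using mult_left_mono[OF lx, of x] x by simp
  finally have bound: "real (2 * m + Suc L + 1) \<le> 88 * (x * ln x)" by simp
  have "(1 - 1 / real m) ^ L \<le> exp (- (1 / real m)) ^ L"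
    using m2 exp_ge_add_one_self[of "- (1 / real m)"] by (intro power_mono) auto
  also have "\<dots> = exp (- (real L / real m))" by (simp flip: exp_of_nat_mult)
  also have "\<dots> < exp (- a)" using L(1) m2 by (simp add: field_simps)
  also have "\<dots> = 1 / (10 * real m)" using m2 by (simp add: a_def exp_minus divide_simps)
  finally have "real m * (1 - 1 / real m) ^ L < 1 / 10" using m2 by (simp add: field_simps)
  moreover have "6 / real m \<le> \<epsilon>" using m m2 assms by (simp add: x_def field_simps)
  ultimately show ?thesis using that[of m L] m2 bound by (simp add: x_def)
qed

lemma smk_instance_enumerated:
  assumes "smk_instance N f c B" "bij_betw e {..<card N} N"
  shows "smk_instance {..<card N} (\<lambda>I. f (e ` I)) (\<lambda>i. c (e i)) B"
proof -
  have inj: "inj_on e {..<card N}" and img: "e ` {..<card N} = N"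
    using assms(2) by (auto simp: bij_betw_def)
  have sub: "e ` I \<subseteq> N" if "I \<subseteq> {..<card N}" for I using that img by blast
  have "submodular_on {..<card N} (\<lambda>I. f (e ` I))"
    unfolding submodular_on_def
  proof (intro allI impI, elim conjE)
    fix S T u assume *: "S \<subseteq> T" "T \<subseteq> {..<card N}" "u \<in> {..<card N}" "u \<notin> T"
    have "e u \<notin> e ` T" using * inj by (auto dest: inj_onD)
    moreover have "e ` S \<subseteq> e ` T" "e ` T \<subseteq> N" "e u \<in> N" using * img by auto
    ultimately show "f (e ` (T \<union> {u})) - f (e ` T) \<le> f (e ` (S \<union> {u})) - f (e ` S)"
      using assms(1) by (simp add: smk_instance_def submodular_on_def)
  qed
  then show ?thesis using assms(1) sub img
    unfolding smk_instance_def monotone_set_fun_on_def by (auto simp: image_mono)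
qed

lemma smk_feasible_enumerated:
  assumes "bij_betw e {..<card N} N" "I \<subseteq> {..<card N}"
  shows "smk_feasible N c B (e ` I) \<longleftrightarrow> smk_feasible {..<card N} (\<lambda>i. c (e i)) B I"
proof -
  have "inj_on e I" "e ` I \<subseteq> N" using assms by (auto simp: bij_betw_def inj_on_subset)
  then show ?thesis using assms(2) by (simp add: smk_feasible_def sum.reindex)
qed

lemma smk_prog_correct:
  assumes inst: "smk_instance N f c B" and e: "bij_betw e {..<card N} N"
    and m: "2 \<le> m" and L: "real m * (1 - 1 / real m) ^ L < 1 / 10"
  shows "\<exists>t S. smk_runs (smk_prog m (2 * m + Suc L)) \<epsilon> N f c B e t S \<and> smk_feasible N c B S \<and>
    (\<forall>OPT. smk_optimal N f c B OPT \<longrightarrow> (1/2 - 6 / real m) * f OPT \<le> f S) \<and>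
    t \<le> (2 * m + Suc L + 1) * (400 * card N + 200)"
proof -
  let ?n = "card N" and ?F = "\<lambda>I. f (e ` I)" and ?c = "\<lambda>i. c (e i)"
  interpret smk ?n ?F ?c B by standard (rule smk_instance_enumerated[OF inst e])
  let ?s = "smk_input \<epsilon> N c B e"
  have "halts_within ?n ?F (smk_prog m (2 * m + Suc L)) ?s ((2 * m + Suc L + 1) * (400 * ?n + 200))
    (\<lambda>s'. feasible (array_set ?n s' 0) \<and>
      (\<exists>G \<tau> \<beta>. reach m (?F (estimate_set ?n)) (2 * m + Suc L) G \<tau> \<beta> \<and> \<beta> \<le> ?F (array_set ?n s' 0)))"
    by (rule halts_smk_prog) (auto simp: smk_input_def input_ok_def array_set_def)
  then obtain t s G \<tau> \<beta> where run: "exec ?n ?F (smk_prog m (2 * m + Suc L)) ?s t s"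
    and t: "t \<le> (2 * m + Suc L + 1) * (400 * ?n + 200)"
    and feas: "feasible (array_set ?n s 0)"
    and reach: "reach m (?F (estimate_set ?n)) (2 * m + Suc L) G \<tau> \<beta>"
    and \<beta>: "\<beta> \<le> ?F (array_set ?n s 0)"
    unfolding halts_within_def by blast
  have "(1/2 - 6 / real m) * f OPT \<le> ?F (array_set ?n s 0)" if OPT: "smk_optimal N f c B OPT" for OPT
  proof -
    have "OPT \<subseteq> e ` {..<?n}"
      using OPT e by (auto simp: smk_optimal_def smk_feasible_def bij_betw_def)
    then obtain I where I: "I \<subseteq> {..<?n}" "OPT = e ` I" by (auto simp: subset_image_iff)
    have opt: "smk_optimal {..<?n} ?F ?c B I"
      unfolding smk_optimal_def
    proof (intro conjI allI impI)
      show "feasible I" using OPT smk_feasible_enumerated[OF e I(1)] I(2) by (simp add: smk_optimal_def)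
      show "?F J \<le> ?F I" if "feasible J" for J
        using OPT smk_feasible_enumerated[OF e, of J] that I(2)
        by (auto simp: smk_optimal_def smk_feasible_def)
    qed
    then have "(1/2 - 6 / real m) * ?F I \<le> \<beta>"
      by (intro reach_good[OF opt m _ _ L reach] estimate_lower estimate_upper)
        (auto simp: smk_optimal_def)
    then show ?thesis using \<beta> I(2) by simp
  qed
  moreover have "smk_feasible N c B (e ` array_set ?n s 0)"
    using feas smk_feasible_enumerated[OF e] by (auto simp: smk_feasible_def)
  ultimately show ?thesis using run t unfolding smk_runs_def by blast
qed

text \<open>The program is chosen from the accuracy alone, before the instance. The
  \<open>min\<close> keeps the logarithm positive for large accuracies.\<close>

theorem theorem2:
  shows "\<exists>C>0. \<forall>\<epsilon>::real. \<epsilon> > 0 \<longrightarrow> (\<exists>p.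
    \<forall>(N :: 'a set) f c B e.
      smk_instance N f c B \<and> bij_betw e {..<card N} N \<longrightarrow>
      (\<exists>t S. smk_runs p \<epsilon> N f c B e t S \<and>
        smk_feasible N c B S \<and>
        (\<forall>OPT. smk_optimal N f c B OPT \<longrightarrow> f S \<ge> (1/2 - \<epsilon>) * f OPT) \<and>
        (N \<noteq> {} \<longrightarrow>
          real t \<le> C * (real (card N) * (1 / min \<epsilon> (1/2)) * ln (1 / min \<epsilon> (1/2))))))"
proof (intro exI[of _ "52800::real"] conjI allI impI)
  fix \<epsilon> :: real
  assume "0 < \<epsilon>"
  have card_ge: "1 \<le> card N" if "smk_instance N f c B" "N \<noteq> {}" for N :: "'a set" and f c B
    using that by (simp add: smk_instance_def Suc_leI card_gt_0_iff)
  have OPT_nonneg: "0 \<le> f OPT" if "smk_instance N f c B" "smk_optimal N f c B OPT"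
    for N :: "'a set" and f c B OPT
    using that by (auto simp: smk_instance_def smk_optimal_def smk_feasible_def)
  show "\<exists>p. \<forall>(N :: 'a set) f c B e.
      smk_instance N f c B \<and> bij_betw e {..<card N} N \<longrightarrow>
      (\<exists>t S. smk_runs p \<epsilon> N f c B e t S \<and>
        smk_feasible N c B S \<and>
        (\<forall>OPT. smk_optimal N f c B OPT \<longrightarrow> f S \<ge> (1/2 - \<epsilon>) * f OPT) \<and>
        (N \<noteq> {} \<longrightarrow>
          real t \<le> 52800 * (real (card N) * (1 / min \<epsilon> (1/2)) * ln (1 / min \<epsilon> (1/2)))))"
  proof (cases "\<epsilon> < 1/2")
    case True
    obtain m L :: nat where m: "2 \<le> m" "6 / real m \<le> \<epsilon>" and L: "real m * (1 - 1 / real m) ^ L < 1 / 10"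
      and time: "real (2 * m + Suc L + 1) \<le> 88 * (1 / \<epsilon> * ln (1 / \<epsilon>))"
      using smk_parameters[OF \<open>0 < \<epsilon>\<close> True] by blast
    show ?thesis
    proof (intro exI[of _ "smk_prog m (2 * m + Suc L)"] allI impI, elim conjE)
      fix N :: "'a set" and f c B e
      assume inst: "smk_instance N f c B" and e: "bij_betw e {..<card N} N"
      obtain t S where S: "smk_runs (smk_prog m (2 * m + Suc L)) \<epsilon> N f c B e t S"
        "smk_feasible N c B S"
        "\<And>OPT. smk_optimal N f c B OPT \<Longrightarrow> (1/2 - 6 / real m) * f OPT \<le> f S"
        and t: "t \<le> (2 * m + Suc L + 1) * (400 * card N + 200)"
        using smk_prog_correct[OF inst e m(1) L] by blast
      have "(1/2 - \<epsilon>) * f OPT \<le> f S" if "smk_optimal N f c B OPT" for OPT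
      proof -
        have "(1/2 - \<epsilon>) * f OPT \<le> (1/2 - 6 / real m) * f OPT"
          using m OPT_nonneg[OF inst that] by (intro mult_right_mono) auto
        then show ?thesis using S(3)[OF that] by linarith
      qed
      moreover have "real t \<le> 52800 * (real (card N) * (1 / min \<epsilon> (1/2)) * ln (1 / min \<epsilon> (1/2)))"
        if "N \<noteq> {}"
      proof -
        \<comment> \<open>A nonempty ground set absorbs the additive 200; together with the factor
          88 for the rounds this gives 52800 = 88 * 600.\<close>
        have "t \<le> (2 * m + Suc L + 1) * (600 * card N)"
          by (rule order_trans[OF t]) (use card_ge[OF inst that] in \<open>intro mult_left_mono; simp\<close>)
        then have "real t \<le> real (2 * m + Suc L + 1) * (600 * real (card N))"
          by (metis of_nat_le_iff of_nat_mult of_nat_numeral)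
        also have "\<dots> \<le> 88 * (1 / \<epsilon> * ln (1 / \<epsilon>)) * (600 * real (card N))"
          using time by (rule mult_right_mono) simp
        finally show ?thesis using True by (simp add: min_absorb1 mult_ac)
      qed
      ultimately show "\<exists>t S. smk_runs (smk_prog m (2 * m + Suc L)) \<epsilon> N f c B e t S \<and>
        smk_feasible N c B S \<and>
        (\<forall>OPT. smk_optimal N f c B OPT \<longrightarrow> f S \<ge> (1/2 - \<epsilon>) * f OPT) \<and>
        (N \<noteq> {} \<longrightarrow>
          real t \<le> 52800 * (real (card N) * (1 / min \<epsilon> (1/2)) * ln (1 / min \<epsilon> (1/2))))"
        using S(1,2) by blast
    qed
  next
    case False
    \<comment> \<open>The required ratio is non-positive here, so the empty set, left in array 0 by
      \<open>Skip\<close>, is good enough.\<close>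
    show ?thesis
    proof (intro exI[of _ Skip] allI impI, elim conjE)
      fix N :: "'a set" and f c B e
      assume inst: "smk_instance N f c B" and e: "bij_betw e {..<card N} N"
      have "smk_runs Skip \<epsilon> N f c B e 1 {}"
        unfolding smk_runs_def
        by (intro exI[of _ "smk_input \<epsilon> N c B e"] conjI exec.Skip) (simp add: smk_input_def array_set_def)
      moreover have "smk_feasible N c B {}" "0 \<le> f {}"
        using inst by (auto simp: smk_feasible_def smk_instance_def)
      moreover have "(1/2 - \<epsilon>) * f OPT \<le> 0" if "smk_optimal N f c B OPT" for OPT
        using False OPT_nonneg[OF inst that] by (intro mult_nonpos_nonneg) auto
      moreover have "real 1 \<le> 52800 * (real (card N) * (1 / min \<epsilon> (1/2)) * ln (1 / min \<epsilon> (1/2)))"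
        if "N \<noteq> {}"
      proof -
        have "1 * (1/2) \<le> real (card N) * ln 2"
          using card_ge[OF inst that] half_le_ln2 by (intro mult_mono) auto
        then show ?thesis using False by (simp add: min_absorb2)
      qed
      ultimately show "\<exists>t S. smk_runs Skip \<epsilon> N f c B e t S \<and>
        smk_feasible N c B S \<and>
        (\<forall>OPT. smk_optimal N f c B OPT \<longrightarrow> f S \<ge> (1/2 - \<epsilon>) * f OPT) \<and>
        (N \<noteq> {} \<longrightarrow>
          real t \<le> 52800 * (real (card N) * (1 / min \<epsilon> (1/2)) * ln (1 / min \<epsilon> (1/2))))"
        by (meson order_trans)
    qed
  qed
qed simp

end
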